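(* Let $0<p\leq 1$. If $\Lambda\subset\mathbb{D}$ is a separated sequence such that $$\sum_{z_n\in\Lambda}(1-|z_n|)^p\,\delta_{z_n}$$ is a $p$-Carleson measure, then there exists a function $A=A(\Lambda)$ analytic in $\mathbb{D}$ such that $|A(z)|^2(1-|z|^2)^{2+p}\,dm(z)$ is a $p$-Carleson measure and the differential equation $f''+Af=0$ admits a non-trivial solution (analytic in $\mathbb{D}$) whose zero-sequence is $\Lambda$.
   Context: $\mathbb{D}$ is the open unit disc of $\mathbb{C}$, $dm(z)$ is the Lebesgue area measure on $\mathbb{D}$, and $\delta_z$ is the Dirac mass at $z\in\mathbb{D}$. A solution $f$ is non-trivial if $f\not\equiv0$. A sequence $\Lambda=\{z_n\}\subset\mathbb{D}$ is separated if there is a constant $\delta>0$ such that $|z_n-z_k|/|1-\overline{z}_nz_k|>\delta$ for all $n\neq k$. For $0<p<\infty$, a positive Borel measure $\mu$ on $\mathbb{D}$ is a $p$-Carleson measure if $$\sup_{I\subset\partial\mathbb{D}}\frac{\mu(Q(I))}{|I|^p}<\infty,\qquad Q(I)=\{re^{i\theta}:1-|I|\leq r<1,\ e^{i\theta}\in I\},$$ where the supremum is over all subarcs $I\subset\partial\mathbb{D}$ and $|I|$ is the length of $I$ normalized so that $|\partial\mathbb{D}|=1$. *)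

theory Defs
  imports "HOL-Complex_Analysis.Complex_Analysis"
begin

abbreviation unit_disc :: "complex set" where
  "unit_disc \<equiv> ball 0 1"

text \<open>
  A finite or infinite sequence of points is a map \<open>z\<close> on an index set \<open>N\<close> of natural
  numbers; only the values of \<open>z\<close> on \<open>N\<close> matter.
\<close>

definition separated_seq :: "nat set \<Rightarrow> (nat \<Rightarrow> complex) \<Rightarrow> bool" where
  "separated_seq N z \<longleftrightarrow>
     (\<exists>\<delta>>0. \<forall>n\<in>N. \<forall>k\<in>N. n \<noteq> k \<longrightarrow>
        norm (z n - z k) / norm (1 - cnj (z n) * z k) > \<delta>)"

text \<open>
  A subarc \<open>I\<close> of the unit circle is given as \<open>cis ` J\<close> for an interval \<open>J\<close> of angles
  (open, closed or half-open) whose length lies between \<open>0\<close> and \<open>2 * pi\<close>; the length of \<open>I\<close>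
  is then that of \<open>J\<close> divided by \<open>2 * pi\<close>. Arcs of length \<open>0\<close> are left out, since the
  quotient in the Carleson condition makes no sense for them. Unbounded intervals are left
  out as well, because \<open>measure\<close> assigns them the value \<open>0\<close>.
\<close>

definition arc_angles :: "real set set" where
  "arc_angles = {J. is_interval J \<and> 0 < measure lborel J \<and> measure lborel J \<le> 2 * pi}"

definition arc_length :: "real set \<Rightarrow> real" where
  "arc_length J = measure lborel J / (2 * pi)"

definition carleson_square :: "real set \<Rightarrow> complex set" where
  "carleson_square J =
     {rcis r \<theta> | r \<theta>. 1 - arc_length J \<le> r \<and> r < 1 \<and> cis \<theta> \<in> cis ` J}"

definition carleson_measure :: "real \<Rightarrow> complex measure \<Rightarrow> bool" where
  "carleson_measure p \<mu> \<longleftrightarrow>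
     sets \<mu> = sets (restrict_space borel unit_disc) \<and>
     (SUP J\<in>arc_angles. emeasure \<mu> (carleson_square J) / ennreal (arc_length J powr p)) < \<infinity>"

text \<open>
  The sum over \<open>n \<in> N\<close> of the Dirac masses at \<open>z n\<close> with weights \<open>w n\<close>, as a Borel measure
  on the disc: the image under \<open>z\<close> of the measure on \<open>N\<close> that gives \<open>n\<close> the mass \<open>w n\<close>.
\<close>

definition dirac_sum :: "nat set \<Rightarrow> (nat \<Rightarrow> real) \<Rightarrow> (nat \<Rightarrow> complex) \<Rightarrow> complex measure" where
  "dirac_sum N w z =
     distr (point_measure N (\<lambda>n. ennreal (w n))) (restrict_space borel unit_disc) z"

lemma emeasure_dirac_sum:
  assumes "\<And>n. n \<in> N \<Longrightarrow> z n \<in> unit_disc" and "E \<in> sets (restrict_space borel unit_disc)"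
  shows "emeasure (dirac_sum N w z) E =
           (\<integral>\<^sup>+ n. ennreal (w n) * indicator E (z n) \<partial>count_space N)"
proof -
  have z: "z \<in> measurable (point_measure N (\<lambda>n. ennreal (w n))) (restrict_space borel unit_disc)"
    using assms(1) by (auto simp: measurable_point_measure_eq1 space_restrict_space)
  have "emeasure (dirac_sum N w z) E =
          emeasure (point_measure N (\<lambda>n. ennreal (w n))) (z -` E \<inter> N)"
    unfolding dirac_sum_def by (subst emeasure_distr[OF z assms(2)]) (simp add: space_point_measure)
  also have "\<dots> = (\<integral>\<^sup>+ n. ennreal (w n) * indicator (z -` E \<inter> N) n \<partial>count_space N)"
    unfolding point_measure_def by (subst emeasure_density) auto
  also have "\<dots> = (\<integral>\<^sup>+ n. ennreal (w n) * indicator E (z n) \<partial>count_space N)"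
    by (intro nn_integral_cong) (auto simp: indicator_def)
  finally show ?thesis .
qed

text \<open>
  Zeros are counted with multiplicity: each point of the disc occurs in the sequence exactly as
  often as its order as a zero of \<open>f\<close>, where \<open>zorder f w = 0\<close> if \<open>f w \<noteq> 0\<close>. The notion is
  meant for holomorphic \<open>f\<close> that do not vanish identically.
\<close>

definition zero_sequence :: "(complex \<Rightarrow> complex) \<Rightarrow> nat set \<Rightarrow> (nat \<Rightarrow> complex) \<Rightarrow> bool" where
  "zero_sequence f N z \<longleftrightarrow>
     (\<forall>n\<in>N. z n \<in> unit_disc) \<and>
     (\<forall>w\<in>unit_disc. finite {n\<in>N. z n = w} \<and> zorder f w = int (card {n\<in>N. z n = w}))"

lemma zero_sequence_zeros:
  assumes "zero_sequence f N z" and f: "f holomorphic_on unit_disc"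
    and nz: "\<exists>w\<in>unit_disc. f w \<noteq> 0"
  shows "{w\<in>unit_disc. f w = 0} = z ` N"
proof -
  have "f w = 0 \<longleftrightarrow> w \<in> z ` N" if w: "w \<in> unit_disc" for w
  proof -
    have fin: "finite {n\<in>N. z n = w}" and ord: "zorder f w = int (card {n\<in>N. z n = w})"
      using assms(1) w by (auto simp: zero_sequence_def)
    obtain b where b: "b \<in> unit_disc" "f b \<noteq> 0" using nz by blast
    have "\<forall>\<^sub>F x in at w. f x \<noteq> 0 \<and> x \<in> unit_disc"
      by (rule non_zero_neighbour_alt[OF f _ _ w b]) auto
    then have "\<exists>\<^sub>F x in at w. f x \<noteq> 0"
      by (auto elim: eventually_frequentlyE)
    then have "f w = 0 \<longleftrightarrow> zorder f w > 0"
      using zorder_pos_iff[OF f open_ball w] by simp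
    also have "\<dots> \<longleftrightarrow> w \<in> z ` N" using ord fin by (auto simp: card_gt_0_iff)
    finally show ?thesis .
  qed
  moreover have "z ` N \<subseteq> unit_disc" using assms(1) by (auto simp: zero_sequence_def)
  ultimately show ?thesis by blast
qed

end

theory Submission imports Defs begin

text \<open>
  Let \<open>P\<close> be the convergent product of the factors \<open>(1 - u n) * exp (u n)\<close> with
  \<open>u n w = (1 - (norm (z n))\<^sup>2) / (1 - cnj (z n) * w)\<close>. Its zeros are the \<open>z n\<close>, and the
  exponentials make its logarithmic derivative decay faster off the zeros than that of the
  Blaschke product, which is what the case \<open>p = 1\<close> needs. The solution is \<open>f = P * exp g\<close>: the
  coefficient \<open>A = - f'' / f\<close> has no pole at \<open>z n\<close> as soon as \<open>h = g'\<close> takes a prescribed value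
  of size \<open>O(1 / (1 - norm (z n)))\<close> there. The Carleson condition and separation bound finite
  Blaschke products at the points \<open>z n\<close> from below, so finite interpolation problems are solved
  by an explicit sum, and Montel's theorem yields \<open>h\<close>.

  Everything is controlled by the kernel \<open>K w = (\<Sum>n. (1 - norm (z n))\<^sup>2 / norm (1 - cnj (z n) * w) ^ 3)\<close>.
  Both \<open>h\<close> and, off the zeros, \<open>f' / f\<close> are \<open>O(K)\<close>, so the Cauchy estimate and the maximum
  principle give \<open>A w = O(K w / (1 - norm w))\<close>. Since \<open>K w = O(1 / (1 - norm w))\<close>, the density is
  \<open>O(K w * (1 - norm w) powr (p - 1))\<close>, which is integrated over a Carleson square term by term.
\<close>

section \<open>Area integrals of powers of the kernel\<close>

text \<open>The obstacle: the bound \<open>A w = O((1 - norm w) powr (-2))\<close> alone is useless,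
  since it makes the density of order \<open>(1 - norm w) powr (p - 2)\<close>, which is not
  integrable up to the circle. One factor \<open>K\<close> must survive, so \<open>h\<close> has to
  decay away from the points as fast as the logarithmic derivative of the product.

  The exponents in \<open>K\<close> come from the area integral of
  \<open>(1 - norm w) powr (p - 1) / norm (1 - cnj a * w) ^ s\<close>, which is of order
  \<open>(1 - norm a) powr (p + 1 - s)\<close> for \<open>s > p + 1\<close>. A Blaschke product
  would give terms \<open>(1 - norm a) / norm (1 - cnj a * w) ^ 2\<close>, so \<open>s = 2\<close>,
  and a logarithm appears at \<open>p = 1\<close>. With \<open>s = 3\<close> and numerator
  \<open>(1 - norm a) ^ 2\<close> each term integrates to order \<open>(1 - norm a) powr p\<close>
  for all \<open>p\<close> up to 1, which is the mass that the hypothesis puts at \<open>a\<close>.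

  The prescribed values: near a simple zero \<open>a\<close>, \<open>f w = (w - a) * H w\<close> has
  \<open>f''(a) = 2 * H'(a)\<close>, so \<open>f''\<close> vanishes at \<open>a\<close> iff the
  logarithmic derivative of \<open>H\<close> does, and the latter is \<open>h a\<close> plus a known
  number.\<close>

lemma measurable_Complex:
  "(\<lambda>(x, y). Complex x y) \<in> borel_measurable (lborel \<Otimes>\<^sub>M lborel)"
  unfolding lborel_prod measurable_lborel1 measurable_lborel2 split_beta
  by (intro borel_measurable_continuous_onI continuous_intros)

lemma distr_Complex_lborel:
  "distr (lborel \<Otimes>\<^sub>M lborel) borel (\<lambda>(x, y). Complex x y) = lborel"
proof (rule lborel_eqI[symmetric])
  fix l u :: complex
  assume le: "\<And>b. b \<in> Basis \<Longrightarrow> l \<bullet> b \<le> u \<bullet> b"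
  have "emeasure (distr (lborel \<Otimes>\<^sub>M lborel) borel (\<lambda>(x, y). Complex x y)) (box l u) =
        emeasure (lborel \<Otimes>\<^sub>M lborel) ({Re l<..<Re u} \<times> {Im l<..<Im u})"
    by (subst emeasure_distr[OF measurable_Complex])
       (auto simp: in_box_complex_iff space_pair_measure intro!: arg_cong2[where f=emeasure])
  also have "\<dots> = emeasure lborel {Re l<..<Re u} * emeasure lborel {Im l<..<Im u}"
    by (rule lborel.emeasure_pair_measure_Times) auto
  also have "\<dots> = ennreal (\<Prod>b\<in>Basis. (u - l) \<bullet> b)"
    using le[of 1] le[of \<i>]
    by (simp add: Basis_complex_def ennreal_mult)
  finally show "emeasure (distr (lborel \<Otimes>\<^sub>M lborel) borel (\<lambda>(x, y). Complex x y)) (box l u) =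
        ennreal (\<Prod>b\<in>Basis. (u - l) \<bullet> b)" .
qed auto

text \<open>Both orders of integration are used: the disc will be cut along the lines where real and
  imaginary part have equal modulus, and on each piece the larger coordinate is the inner
  variable.\<close>

lemma nn_integral_lborel_Complex:
  assumes [measurable]: "f \<in> borel_measurable borel"
  shows "(\<integral>\<^sup>+ w. f w \<partial>lborel) = (\<integral>\<^sup>+ x. \<integral>\<^sup>+ y. f (Complex x y) \<partial>lborel \<partial>lborel)"
    and "(\<integral>\<^sup>+ w. f w \<partial>lborel) = (\<integral>\<^sup>+ y. \<integral>\<^sup>+ x. f (Complex x y) \<partial>lborel \<partial>lborel)"
proof -
  have f': "(\<lambda>x. f (case x of (x, y) \<Rightarrow> Complex x y)) \<in> borel_measurable (lborel \<Otimes>\<^sub>M lborel)"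
    by (rule measurable_compose[OF measurable_Complex assms])
  have "(\<integral>\<^sup>+ w. f w \<partial>lborel) =
        (\<integral>\<^sup>+ w. f w \<partial>distr (lborel \<Otimes>\<^sub>M lborel) borel (\<lambda>(x, y). Complex x y))"
    by (simp add: distr_Complex_lborel)
  also have "\<dots> = (\<integral>\<^sup>+ x. f (case x of (x, y) \<Rightarrow> Complex x y) \<partial>(lborel \<Otimes>\<^sub>M lborel))"
    by (rule nn_integral_distr[OF measurable_Complex]) simp
  finally have eq: "(\<integral>\<^sup>+ w. f w \<partial>lborel) =
    (\<integral>\<^sup>+ x. f (case x of (x, y) \<Rightarrow> Complex x y) \<partial>(lborel \<Otimes>\<^sub>M lborel))" .
  show "(\<integral>\<^sup>+ w. f w \<partial>lborel) = (\<integral>\<^sup>+ x. \<integral>\<^sup>+ y. f (Complex x y) \<partial>lborel \<partial>lborel)"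
    unfolding eq by (subst lborel.nn_integral_fst[symmetric, OF f']) simp
  show "(\<integral>\<^sup>+ w. f w \<partial>lborel) = (\<integral>\<^sup>+ y. \<integral>\<^sup>+ x. f (Complex x y) \<partial>lborel \<partial>lborel)"
    unfolding eq by (subst lborel_pair.nn_integral_snd[symmetric]) (use f' in \<open>auto simp: split_beta\<close>)
qed

text \<open>Cut at \<open>t = d\<close>. Below, \<open>d + t\<close> is replaced by
  \<open>d\<close>, and \<open>t powr (p - 1)\<close> is integrable at 0 as \<open>p > 0\<close>;
  above, it is replaced by \<open>t\<close>, and \<open>t powr (p - 5/2)\<close> is integrable at
  infinity as \<open>p < 3/2\<close>. Both pieces scale like \<open>d powr (p - 3/2)\<close>, and
  \<open>p \<le> 1\<close> bounds \<open>1 / (3/2 - p)\<close> by 2.\<close>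

lemma nn_integral_powr_decay:
  fixes p d :: real
  assumes p: "0 < p" "p \<le> 1" and d: "0 < d"
  shows "(\<integral>\<^sup>+ t. ennreal (t powr (p - 1) * (d + t) powr (-3/2)) * indicator {0<..} t \<partial>lborel)
          \<le> ennreal ((1 / p + 2) * d powr (p - 3/2))"
proof -
  have 1: "(\<integral>\<^sup>+ t. ennreal (t powr (p - 1)) * indicator {0..d} t \<partial>lborel) = ennreal (d powr p / p)"
    using nn_integral_has_integral_lebesgue'[OF _ has_integral_powr_from_0[of "p - 1" d]] p d by simp
  have 2: "(\<integral>\<^sup>+ t. ennreal (t powr (p - 5/2)) * indicator {d..} t \<partial>lborel) =
           ennreal (d powr (p - 3/2) / (3/2 - p))"
    using nn_integral_has_integral_lebesgue'[OF _ has_integral_powr_to_inf[of "p - 5/2" d]] p d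
    by (simp add: divide_simps algebra_simps)
  have "(\<integral>\<^sup>+ t. ennreal (t powr (p - 1) * (d + t) powr (-3/2)) * indicator {0<..} t \<partial>lborel)
     \<le> (\<integral>\<^sup>+ t. ennreal (d powr (-3/2)) * (ennreal (t powr (p - 1)) * indicator {0..d} t) +
           ennreal (t powr (p - 5/2)) * indicator {d..} t \<partial>lborel)"
  proof (rule nn_integral_mono)
    fix t :: real
    show "ennreal (t powr (p - 1) * (d + t) powr (-3/2)) * indicator {0<..} t \<le>
      ennreal (d powr (-3/2)) * (ennreal (t powr (p - 1)) * indicator {0..d} t) +
           ennreal (t powr (p - 5/2)) * indicator {d..} t"
    proof (cases "t \<le> 0")
      case True then show ?thesis by simp
    next
      case False
      then have t: "t > 0" by simp
      show ?thesis
      proof (cases "t \<le> d")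
        case True
        have "t powr (p - 1) * (d + t) powr (-3/2) \<le> d powr (-3/2) * t powr (p - 1)"
          using t d by (subst mult.commute) (intro mult_right_mono powr_mono2', auto)
        then show ?thesis using True t
          by (auto simp: ennreal_mult[symmetric] intro!: ennreal_leI add_increasing2)
      next
        case F: False
        have "t powr (p - 1) * (d + t) powr (-3/2) \<le> t powr (p - 1) * t powr (-3/2)"
          using t d by (intro mult_left_mono powr_mono2') auto
        also have "\<dots> = t powr (p - 5/2)"
          using t by (simp add: powr_add[symmetric] algebra_simps)
        finally show ?thesis using F t by (auto intro!: ennreal_leI)
      qed
    qed
  qed
  also have "\<dots> = ennreal (d powr (-3/2)) * ennreal (d powr p / p) + ennreal (d powr (p - 3/2) / (3/2 - p))"
    by (subst nn_integral_add) (auto simp: nn_integral_cmult 1 2)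
  also have "\<dots> = ennreal (d powr (p - 3/2) / p + d powr (p - 3/2) / (3/2 - p))"
    using p d by (simp add: ennreal_mult[symmetric] ennreal_plus[symmetric] powr_add[symmetric] algebra_simps del: ennreal_plus)
  also have "\<dots> \<le> ennreal ((1 / p + 2) * d powr (p - 3/2))"
  proof (rule ennreal_leI)
    have "1 / (3/2 - p) \<le> 2" using p by (simp add: field_simps)
    then have "(1 / (3/2 - p)) * d powr (p - 3/2) \<le> 2 * d powr (p - 3/2)"
      by (rule mult_right_mono) simp
    then show "d powr (p - 3/2) / p + d powr (p - 3/2) / (3/2 - p) \<le> (1 / p + 2) * d powr (p - 3/2)"
      by (simp add: distrib_right)
  qed
  finally show ?thesis .
qed

lemma nn_integral_abs_reflect_le:
  fixes g :: "real \<Rightarrow> ennreal" and s :: real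
  assumes [measurable]: "g \<in> borel_measurable borel"
  shows "(\<integral>\<^sup>+ v. g \<bar>v - s\<bar> \<partial>lborel) = 2 * (\<integral>\<^sup>+ t. g t * indicator {0<..} t \<partial>lborel)"
    and "(\<integral>\<^sup>+ v. g (s - \<bar>v\<bar>) \<partial>lborel) \<le> 2 * (\<integral>\<^sup>+ t. g t \<partial>lborel)"
proof -
  have AE: "AE t in lborel. t \<noteq> (0::real)" by (rule AE_lborel_singleton)
  have "(\<integral>\<^sup>+ v. g \<bar>v - s\<bar> \<partial>lborel) = (\<integral>\<^sup>+ t. g \<bar>t\<bar> \<partial>lborel)"
    by (subst nn_integral_real_affine[where c=1 and t=s]) auto
  also have "\<dots> = (\<integral>\<^sup>+ t. g t * indicator {0<..} t + g (- t) * indicator {0<..} (- t) \<partial>lborel)"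
    using AE by (intro nn_integral_cong_AE) (auto elim!: eventually_mono simp: indicator_def)
  also have "\<dots> = (\<integral>\<^sup>+ t. g t * indicator {0<..} t \<partial>lborel) +
                    (\<integral>\<^sup>+ t. g (- t) * indicator {0<..} (- t) \<partial>lborel)"
    by (rule nn_integral_add) auto
  also have "(\<integral>\<^sup>+ t. g (- t) * indicator {0<..} (- t) \<partial>lborel) = (\<integral>\<^sup>+ t. g t * indicator {0<..} t \<partial>lborel)"
    by (subst nn_integral_real_affine[where c="-1" and t=0]) auto
  finally show "(\<integral>\<^sup>+ v. g \<bar>v - s\<bar> \<partial>lborel) = 2 * (\<integral>\<^sup>+ t. g t * indicator {0<..} t \<partial>lborel)"
    by (simp add: mult_2)
  have "(\<integral>\<^sup>+ v. g (s - \<bar>v\<bar>) \<partial>lborel) \<le> (\<integral>\<^sup>+ v. g (s - v) + g (s + v) \<partial>lborel)"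
    by (intro nn_integral_mono) (auto simp: abs_if add_increasing add_increasing2)
  also have "\<dots> = (\<integral>\<^sup>+ v. g (s - v) \<partial>lborel) + (\<integral>\<^sup>+ v. g (s + v) \<partial>lborel)"
    by (rule nn_integral_add) auto
  also have "(\<integral>\<^sup>+ v. g (s - v) \<partial>lborel) = (\<integral>\<^sup>+ t. g t \<partial>lborel)"
    by (subst (2) nn_integral_real_affine[where c="-1" and t=s]) auto
  also have "(\<integral>\<^sup>+ v. g (s + v) \<partial>lborel) = (\<integral>\<^sup>+ t. g t \<partial>lborel)"
    by (subst (2) nn_integral_real_affine[where c="1" and t=s]) auto
  finally show "(\<integral>\<^sup>+ v. g (s - \<bar>v\<bar>) \<partial>lborel) \<le> 2 * (\<integral>\<^sup>+ t. g t \<partial>lborel)"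
    by (simp add: mult_2)
qed

lemma nn_integral_powr_line:
  fixes d c :: real
  assumes d: "0 < d"
  shows "(\<integral>\<^sup>+ u. ennreal ((d + \<bar>u - c\<bar>) powr (-3/2)) \<partial>lborel) \<le> ennreal (4 * d powr (-1/2))"
proof -
  have 1: "(\<integral>\<^sup>+ t. ennreal (t powr (-3/2)) * indicator {d..} t \<partial>lborel) = ennreal (2 * d powr (-1/2))"
    using nn_integral_has_integral_lebesgue'[OF _ has_integral_powr_to_inf[of "-3/2" d]] d
    by (simp add: field_simps)
  have "(\<integral>\<^sup>+ u. ennreal ((d + \<bar>u - c\<bar>) powr (-3/2)) \<partial>lborel) =
        2 * (\<integral>\<^sup>+ t. ennreal ((d + t) powr (-3/2)) * indicator {0<..} t \<partial>lborel)"
    by (rule nn_integral_abs_reflect_le(1)) simp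
  also have "(\<integral>\<^sup>+ t. ennreal ((d + t) powr (-3/2)) * indicator {0<..} t \<partial>lborel) \<le>
             (\<integral>\<^sup>+ t. ennreal ((d + t) powr (-3/2)) * indicator {d..} (d + t) \<partial>lborel)"
    by (intro nn_integral_mono) (auto simp: indicator_def)
  also have "\<dots> = (\<integral>\<^sup>+ t. ennreal (t powr (-3/2)) * indicator {d..} t \<partial>lborel)"
    by (subst (2) nn_integral_real_affine[where c=1 and t=d]) auto
  also note 1
  also have "2 * ennreal (2 * d powr (-1/2)) = ennreal (4 * d powr (-1/2))"
    by (subst ennreal_numeral[symmetric], subst ennreal_mult[symmetric]) simp_all
  finally show ?thesis by (simp add: mult_left_mono)
qed

text \<open>Divided by the left side, this is the identity for the pseudohyperbolic distance: the
  last product over the squared kernel is \<open>1 - (norm (blaschke a w)) ^ 2\<close>.\<close>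

lemma norm_one_minus_cnj_mult_sq:
  "(norm (1 - cnj a * w))\<^sup>2 = (norm (w - a))\<^sup>2 + (1 - (norm a)\<^sup>2) * (1 - (norm w)\<^sup>2)"
  unfolding cmod_power2 by (simp add: power2_eq_square algebra_simps)

lemma norm_cnj_kernel_commute: "norm (1 - cnj a * w) = norm (1 - cnj w * a)"
  by (metis complex_cnj_cnj complex_cnj_diff complex_cnj_mult complex_cnj_one complex_mod_cnj mult.commute)

lemma norm_cnj_kernel_ge:
  assumes "norm a < 1" "norm w \<le> 1"
  shows "norm (w - a) \<le> norm (1 - cnj a * w)"
    and "1 - norm a \<le> norm (1 - cnj a * w)"
    and "1 - norm w \<le> norm (1 - cnj a * w)"
    and "0 < norm (1 - cnj a * w)"
    and "norm (1 - cnj a * w) \<le> 2"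
proof -
  have "(norm (w - a))\<^sup>2 \<le> (norm (1 - cnj a * w))\<^sup>2"
    unfolding norm_one_minus_cnj_mult_sq using assms
    by (simp add: mult_nonneg_nonneg power_le_one)
  then show "norm (w - a) \<le> norm (1 - cnj a * w)"
    by (rule power2_le_imp_le) simp
  have le: "norm a * norm w \<le> norm a" "norm a * norm w \<le> norm w"
    using assms by (auto intro: mult_left_le mult_left_le_one_le)
  have "1 - norm a * norm w \<le> norm (1 - cnj a * w)"
    using norm_triangle_ineq2[of 1 "cnj a * w"] by (simp add: norm_mult)
  then show a: "1 - norm a \<le> norm (1 - cnj a * w)" "1 - norm w \<le> norm (1 - cnj a * w)"
    using le by linarith+
  show "0 < norm (1 - cnj a * w)" using a(1) assms by linarith
  have "norm (1 - cnj a * w) \<le> 1 + norm a * norm w"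
    using norm_triangle_ineq4[of 1 "cnj a * w"] by (simp add: norm_mult)
  then show "norm (1 - cnj a * w) \<le> 2" using le assms by linarith
qed

text \<open>Cartesian coordinates replace polar ones. Where \<open>v\<close> dominates, the distance
  \<open>t\<close> to the circle in the direction of \<open>v\<close> is at most
  \<open>2 * (1 - norm w)\<close>, so the kernel controls both \<open>d + \<bar>u - c\<bar>\<close>
  and \<open>d + t\<close>. Bounding its square from below by their product splits its cube into two
  powers \<open>3/2\<close>, and the variables can be integrated one at a time. In the application
  \<open>c\<close> is the coordinate of \<open>a\<close> that goes with \<open>u\<close>.\<close>

lemma kernel_integrand_le:
  fixes p u v :: real
  assumes p: "0 < p" "p \<le> 1" and a: "norm a < 1" and w: "norm w < 1"
    and nw: "(norm w)\<^sup>2 = u\<^sup>2 + v\<^sup>2" and c: "\<bar>u - c\<bar> \<le> norm (w - a)" and uv: "\<bar>u\<bar> \<le> \<bar>v\<bar>"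
  defines "d \<equiv> 1 - norm a" and "t \<equiv> sqrt (1 - u\<^sup>2) - \<bar>v\<bar>"
  shows "0 < t"
    and "(1 - norm w) powr (p - 1) / norm (1 - cnj a * w) ^ 3
          \<le> 30 * ((d + \<bar>u - c\<bar>) powr (-3/2) * (t powr (p - 1) * (d + t) powr (-3/2)))"
proof -
  define s where "s = sqrt (1 - u\<^sup>2)"
  define X where "X = norm (1 - cnj a * w)"
  have w2: "(norm w)\<^sup>2 < 1" using w by (simp add: power_less_one_iff abs_square_less_1)
  then have uv1: "u\<^sup>2 + v\<^sup>2 < 1" using nw by simp
  then have u1: "u\<^sup>2 < 1" by (smt (verit) zero_le_power2)
  have s2: "s\<^sup>2 = 1 - u\<^sup>2" and s0: "0 < s" using u1 by (auto simp: s_def)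
  have vs: "\<bar>v\<bar> < s"
    by (rule power2_less_imp_less) (use s2 uv1 s0 in auto)
  then show t: "0 < t" by (simp add: t_def s_def)
  have tX: "t = s - \<bar>v\<bar>" by (simp add: t_def s_def)
  \<comment> \<open>The point \<open>(u, s)\<close> lies on the unit circle, so
    \<open>s + \<bar>u\<bar> \<ge> 1\<close>; with \<open>\<bar>u\<bar> \<le> \<bar>v\<bar>\<close>
    this keeps the factor \<open>s + \<bar>v\<bar>\<close> of
    \<open>1 - (norm w) ^ 2 = t * (s + \<bar>v\<bar>)\<close> away from 0.\<close>
  have "1\<^sup>2 \<le> (s + \<bar>u\<bar>)\<^sup>2"
    using s2 s0 by (simp add: power2_sum)
  then have "1 \<le> s + \<bar>u\<bar>"
    by (rule power2_le_imp_le) (use s0 in auto)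
  then have sv: "1 \<le> s + \<bar>v\<bar>" using uv by simp
  have "(s - \<bar>v\<bar>) * (s + \<bar>v\<bar>) = 1 - (norm w)\<^sup>2"
    using s2 nw by (simp add: power2_eq_square algebra_simps)
  also have "\<dots> = (1 - norm w) * (1 + norm w)"
    by (simp add: power2_eq_square algebra_simps)
  also have "\<dots> \<le> (1 - norm w) * 2"
    using w by (intro mult_left_mono) auto
  finally have "t * (s + \<bar>v\<bar>) \<le> (1 - norm w) * 2" by (simp only: tX)
  moreover have "t * 1 \<le> t * (s + \<bar>v\<bar>)"
    using sv t by (intro mult_left_mono) auto
  ultimately have "t \<le> (1 - norm w) * 2" by linarith
  then have wt: "t / 2 \<le> 1 - norm w" by simp
  have d0: "0 < d" using a by (simp add: d_def)
  have X: "d \<le> X" "1 - norm w \<le> X" "\<bar>u - c\<bar> \<le> X" "0 < X"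
    using norm_cnj_kernel_ge[of a w] a w c by (auto simp: d_def X_def)
  have 1: "(1 - norm w) powr (p - 1) \<le> 2 * t powr (p - 1)"
  proof -
    have "(1 - norm w) powr (p - 1) \<le> (t / 2) powr (p - 1)"
      using t wt p by (intro powr_mono2') auto
    also have "\<dots> = t powr (p - 1) * 2 powr (1 - p)"
      using t by (simp add: powr_divide powr_minus_divide[of 2 "p - 1", simplified])
    also have "2 powr (1 - p) \<le> (2::real) powr 1"
      using p by (intro powr_mono) auto
    finally show ?thesis by (simp add: mult.commute mult_right_mono)
  qed
  have 2: "1 / X ^ 3 \<le> 15 * ((d + \<bar>u - c\<bar>) powr (-3/2) * (d + t) powr (-3/2))"
  proof -
    \<comment> \<open>\<open>Y \<le> 6 * X ^ 2\<close>, because \<open>d\<close> and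
      \<open>\<bar>u - c\<bar>\<close> are at most \<open>X\<close> while
      \<open>t \<le> 2 * X\<close>; the 15 rounds up \<open>6 powr (3/2)\<close>.\<close>
    define Y where "Y = (d + \<bar>u - c\<bar>) * (d + t)"
    have Y: "0 < Y" unfolding Y_def using d0 t by (intro mult_pos_pos) auto
    have "Y \<le> (2 * X) * (3 * X)"
      unfolding Y_def using X d0 t wt by (intro mult_mono) auto
    then have "Y / 6 \<le> X\<^sup>2" by (simp add: power2_eq_square)
    then have "(Y / 6) powr (3/2) \<le> (X\<^sup>2) powr (3/2)"
      using Y by (intro powr_mono2) auto
    also have "(X\<^sup>2) powr (3/2) = X ^ 3"
      using X by (simp add: powr_powr powr_numeral flip: powr_numeral)
    finally have "1 / X ^ 3 \<le> 1 / (Y / 6) powr (3/2)"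
      using Y X by (intro divide_left_mono) auto
    also have "\<dots> = 6 powr (3/2) * Y powr (-3/2)"
      using Y by (simp add: powr_divide powr_minus_divide)
    also have "(6::real) powr (3/2) \<le> 15"
    proof -
      have "((6::real) powr (3/2))\<^sup>2 = 6 ^ 3"
        by (simp add: powr_powr flip: powr_numeral)
      then have "((6::real) powr (3/2))\<^sup>2 \<le> 15\<^sup>2" by simp
      then show ?thesis by (rule power2_le_imp_le) simp
    qed
    finally have "1 / X ^ 3 \<le> 15 * Y powr (-3/2)" by (simp add: mult_right_mono)
    then show ?thesis using d0 t by (simp add: Y_def powr_mult)
  qed
  have "(1 - norm w) powr (p - 1) * (1 / X ^ 3) \<le>
      (2 * t powr (p - 1)) * (15 * ((d + \<bar>u - c\<bar>) powr (-3/2) * (d + t) powr (-3/2)))"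
    using X by (intro mult_mono 1 2) auto
  then show "(1 - norm w) powr (p - 1) / norm (1 - cnj a * w) ^ 3
          \<le> 30 * ((d + \<bar>u - c\<bar>) powr (-3/2) * (t powr (p - 1) * (d + t) powr (-3/2)))"
    by (simp add: X_def algebra_simps)
qed

text \<open>The Forelli-Rudin estimate for kernel exponent 3. The 480 is the pointwise constant 30,
  times 2 for the sign of the dominant coordinate, 4 from the integral over the other one, and 2 for
  the two sectors.\<close>

lemma nn_integral_kernel_le:
  fixes p :: real
  assumes p: "0 < p" "p \<le> 1" and a: "norm a < 1"
  shows "(\<integral>\<^sup>+ w. ennreal ((1 - norm w) powr (p - 1) / norm (1 - cnj a * w) ^ 3) * indicator unit_disc w \<partial>lborel)
          \<le> ennreal (480 * (1 / p + 2) * (1 - norm a) powr (p - 2))"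
proof -
  define d where "d = 1 - norm a"
  have d: "0 < d" using a by (simp add: d_def)
  define h :: "real \<Rightarrow> ennreal"
    where "h t = ennreal (t powr (p - 1) * (d + t) powr (-3/2)) * indicator {0<..} t" for t
  define g :: "real \<Rightarrow> real \<Rightarrow> real \<Rightarrow> ennreal"
    where "g c u v = ennreal (30 * (d + \<bar>u - c\<bar>) powr (-3/2)) * h (sqrt (1 - u\<^sup>2) - \<bar>v\<bar>)" for c u v
  have [measurable]: "h \<in> borel_measurable borel" by (simp add: h_def[abs_def])
  have g_bound: "(\<integral>\<^sup>+ u. \<integral>\<^sup>+ v. g c u v \<partial>lborel \<partial>lborel) \<le> ennreal (240 * (1 / p + 2) * d powr (p - 2))" for c
  proof -
    have "(\<integral>\<^sup>+ v. g c u v \<partial>lborel) \<le>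
       ennreal ((d + \<bar>u - c\<bar>) powr (-3/2)) * ennreal (60 * ((1 / p + 2) * d powr (p - 3/2)))" for u
    proof -
      have "(\<integral>\<^sup>+ v. g c u v \<partial>lborel) =
        ennreal (30 * (d + \<bar>u - c\<bar>) powr (-3/2)) * (\<integral>\<^sup>+ v. h (sqrt (1 - u\<^sup>2) - \<bar>v\<bar>) \<partial>lborel)"
        unfolding g_def by (rule nn_integral_cmult) measurable
      also have "\<dots> \<le> ennreal (30 * (d + \<bar>u - c\<bar>) powr (-3/2)) * (2 * (\<integral>\<^sup>+ t. h t \<partial>lborel))"
        by (intro mult_left_mono nn_integral_abs_reflect_le) auto
      also have "\<dots> \<le> ennreal (30 * (d + \<bar>u - c\<bar>) powr (-3/2)) * (ennreal 2 * ennreal ((1 / p + 2) * d powr (p - 3/2)))"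
        using nn_integral_powr_decay[OF p d] unfolding h_def by (intro mult_left_mono mult_mono) auto
      also have "\<dots> = ennreal ((d + \<bar>u - c\<bar>) powr (-3/2)) * ennreal (60 * ((1 / p + 2) * d powr (p - 3/2)))"
        using p by (simp only: ennreal_mult''[symmetric] ennreal_mult'[symmetric]) (simp add: ennreal_mult'[symmetric] mult_ac)
      finally show ?thesis .
    qed
    then have "(\<integral>\<^sup>+ u. \<integral>\<^sup>+ v. g c u v \<partial>lborel \<partial>lborel) \<le>
       (\<integral>\<^sup>+ u. ennreal ((d + \<bar>u - c\<bar>) powr (-3/2)) * ennreal (60 * ((1 / p + 2) * d powr (p - 3/2))) \<partial>lborel)"
      by (intro nn_integral_mono)
    also have "\<dots> = (\<integral>\<^sup>+ u. ennreal ((d + \<bar>u - c\<bar>) powr (-3/2)) \<partial>lborel) * ennreal (60 * ((1 / p + 2) * d powr (p - 3/2)))"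
      by (rule nn_integral_multc) simp
    also have "\<dots> \<le> ennreal (4 * d powr (-1/2)) * ennreal (60 * ((1 / p + 2) * d powr (p - 3/2)))"
      by (intro mult_right_mono nn_integral_powr_line d) simp
    also have "\<dots> = ennreal (240 * (1 / p + 2) * (d powr (-1/2) * d powr (p - 3/2)))"
      using p by (subst ennreal_mult[symmetric]) (auto simp: mult_ac)
    also have "d powr (-1/2) * d powr (p - 3/2) = d powr (p - 2)"
      by (simp add: powr_add[symmetric])
    finally show ?thesis .
  qed
  define \<phi> :: "complex \<Rightarrow> ennreal"
    where "\<phi> w = ennreal ((1 - norm w) powr (p - 1) / norm (1 - cnj a * w) ^ 3) * indicator unit_disc w" for w
  have disc [measurable]: "unit_disc \<in> sets borel" by simp
  have [measurable]: "\<phi> \<in> borel_measurable borel" unfolding \<phi>_def[abs_def] by measurable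
  have pw: "\<phi> w \<le> g c u v" if "(norm w)\<^sup>2 = u\<^sup>2 + v\<^sup>2" "\<bar>u - c\<bar> \<le> norm (w - a)" "\<bar>u\<bar> \<le> \<bar>v\<bar>" for w c u v
  proof (cases "norm w < 1")
    case True
    note k = kernel_integrand_le[OF p a True that]
    have "\<phi> w = ennreal ((1 - norm w) powr (p - 1) / norm (1 - cnj a * w) ^ 3)"
      using True by (simp add: \<phi>_def)
    also have "\<dots> \<le> g c u v"
      using ennreal_leI[OF k(2)] k(1) by (simp add: g_def h_def d_def ennreal_mult[symmetric] mult_ac)
    finally show ?thesis .
  qed (simp add: \<phi>_def)
  have ReIm: "\<bar>Re w - Re a\<bar> \<le> norm (w - a)" "\<bar>Im w - Im a\<bar> \<le> norm (w - a)" for w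
    using abs_Re_le_cmod[of "w - a"] abs_Im_le_cmod[of "w - a"] by auto
  \<comment> \<open>In each sector the dominant coordinate plays the role of \<open>v\<close>;
    adding the two majorants avoids cutting the domain of integration.\<close>
  have "\<phi> w \<le> g (Re a) (Re w) (Im w) + g (Im a) (Im w) (Re w)" for w
  proof (cases "\<bar>Re w\<bar> \<le> \<bar>Im w\<bar>")
    case True
    then have "\<phi> w \<le> g (Re a) (Re w) (Im w)" by (intro pw ReIm) (auto simp: cmod_power2)
    then show ?thesis by (simp add: add_increasing2)
  next
    case False
    then have "\<phi> w \<le> g (Im a) (Im w) (Re w)" by (intro pw ReIm) (auto simp: cmod_power2)
    then show ?thesis by (simp add: add_increasing)
  qed
  then have "(\<integral>\<^sup>+ w. \<phi> w \<partial>lborel) \<le> (\<integral>\<^sup>+ w. g (Re a) (Re w) (Im w) + g (Im a) (Im w) (Re w) \<partial>lborel)"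
    by (intro nn_integral_mono)
  also have "\<dots> = (\<integral>\<^sup>+ w. g (Re a) (Re w) (Im w) \<partial>lborel) + (\<integral>\<^sup>+ w. g (Im a) (Im w) (Re w) \<partial>lborel)"
    by (rule nn_integral_add) (auto simp: g_def[abs_def])
  also have "(\<integral>\<^sup>+ w. g (Re a) (Re w) (Im w) \<partial>lborel) = (\<integral>\<^sup>+ u. \<integral>\<^sup>+ v. g (Re a) u v \<partial>lborel \<partial>lborel)"
    by (subst nn_integral_lborel_Complex(1)) (auto simp: g_def[abs_def])
  also have "(\<integral>\<^sup>+ w. g (Im a) (Im w) (Re w) \<partial>lborel) = (\<integral>\<^sup>+ u. \<integral>\<^sup>+ v. g (Im a) u v \<partial>lborel \<partial>lborel)"
    by (subst nn_integral_lborel_Complex(2)) (auto simp: g_def[abs_def])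
  also have "(\<integral>\<^sup>+ u. \<integral>\<^sup>+ v. g (Re a) u v \<partial>lborel \<partial>lborel) + (\<integral>\<^sup>+ u. \<integral>\<^sup>+ v. g (Im a) u v \<partial>lborel \<partial>lborel)
     \<le> ennreal (240 * (1 / p + 2) * d powr (p - 2)) + ennreal (240 * (1 / p + 2) * d powr (p - 2))"
    by (intro add_mono g_bound)
  also have "\<dots> = ennreal (480 * (1 / p + 2) * d powr (p - 2))"
    using p by (subst ennreal_plus[symmetric]) auto
  finally show ?thesis by (simp add: \<phi>_def d_def)
qed

section \<open>Carleson measures and kernel sums\<close>

text \<open>Jordan's inequality with 1/2 in place of 2/pi. Up to \<open>pi / 3\<close> the
  difference increases, since the cosine is at least 1/2; beyond, the sine is at least 4/5 while
  \<open>x / 2 \<le> pi / 4\<close>.\<close>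

lemma half_le_sin:
  fixes x :: real
  assumes "0 \<le> x" "x \<le> pi / 2" shows "x / 2 \<le> sin x"
proof (cases "x \<le> pi / 3")
  case True
  have "sin 0 - 0 / 2 \<le> sin x - x / 2"
  proof (rule DERIV_nonneg_imp_nondecreasing[OF assms(1)])
    fix y assume y: "0 \<le> y" "y \<le> x"
    have "cos (pi / 3) \<le> cos y"
      using y True pi_gt_zero by (intro cos_monotone_0_pi_le) auto
    then have "0 \<le> cos y - 1 / 2" by (simp add: cos_60)
    moreover have "((\<lambda>y. sin y - y / 2) has_real_derivative (cos y - 1 / 2)) (at y)"
      by (auto intro!: derivative_eq_intros)
    ultimately show "\<exists>D. ((\<lambda>y. sin y - y / 2) has_real_derivative D) (at y) \<and> 0 \<le> D" by blast
  qed
  then show ?thesis by simp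
next
  case False
  have "sin (pi / 3) \<le> sin x"
    using False assms by (intro sin_monotone_2pi_le) auto
  moreover have "4 / 5 \<le> sin (pi / 3)"
    unfolding sin_60 using real_le_rsqrt[of "8/5" 3] by (simp add: power2_eq_square)
  moreover have "x / 2 \<le> 4 / 5" using assms pi_less_4 pi_approx by simp
  ultimately show ?thesis by linarith
qed

lemma abs_le_norm_cis_minus_1:
  assumes "\<bar>t\<bar> \<le> pi" shows "\<bar>t\<bar> \<le> 2 * norm (cis t - 1)"
proof -
  have "norm (cis t - 1) = 2 * \<bar>sin (t / 2)\<bar>"
    using dist_exp_i_1[of t] by (simp add: cis_conv_exp)
  moreover have "\<bar>t\<bar> / 2 / 2 \<le> sin (\<bar>t\<bar> / 2)"
    by (rule half_le_sin) (use assms in auto)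
  moreover have "sin (\<bar>t\<bar> / 2) \<le> \<bar>sin (t / 2)\<bar>"
    by (auto simp: abs_if)
  ultimately show ?thesis by linarith
qed

section \<open>Carleson squares and kernel balls\<close>

lemma arc_angles_symmetric:
  assumes "0 < h" "h \<le> pi"
  shows "{t - h..t + h} \<in> arc_angles" and "arc_length {t - h..t + h} = h / pi"
  using assms by (auto simp: arc_angles_def arc_length_def is_interval_cc)

lemma carleson_square_borel:
  assumes "compact J" and le1: "arc_length J \<le> 1"
  shows "carleson_square J \<in> sets (restrict_space borel unit_disc)"
proof -
  have comp: "compact ((\<lambda>(r, \<theta>). rcis r \<theta>) ` ({1 - arc_length J..1} \<times> J))"
    by (intro compact_continuous_image compact_Times assms)
      (auto simp: split_beta rcis_def cis_conv_exp intro!: continuous_intros)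
  have "carleson_square J = unit_disc \<inter> (\<lambda>(r, \<theta>). rcis r \<theta>) ` ({1 - arc_length J..1} \<times> J)"
    (is "?L = ?R")
  proof (intro equalityI subsetI)
    fix w assume "w \<in> ?L"
    then obtain r \<theta> \<theta>' where *: "w = rcis r \<theta>" "1 - arc_length J \<le> r" "r < 1" "\<theta>' \<in> J" "cis \<theta> = cis \<theta>'"
      unfolding carleson_square_def by auto
    then have "w = rcis r \<theta>'" by (simp add: rcis_def)
    then show "w \<in> ?R" using * le1 by (auto simp: image_iff intro!: bexI[of _ "(r, \<theta>')"])
  next
    fix w assume "w \<in> ?R"
    then obtain r \<theta> where *: "w = rcis r \<theta>" "1 - arc_length J \<le> r" "r \<le> 1" "\<theta> \<in> J" "norm w < 1"
      by auto
    then have "r < 1" using * le1 by (auto simp: rcis_def norm_mult)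
    then show "w \<in> ?L" unfolding carleson_square_def using * by blast
  qed
  then show ?thesis
    using borel_closed[OF compact_imp_closed[OF comp]] by (auto simp: sets_restrict_space)
qed

text \<open>A kernel below \<open>r\<close> forces \<open>1 - norm a\<close>,
  \<open>1 - norm w\<close> and \<open>norm (w - a)\<close> below \<open>r\<close>. The radial
  projections to the circle are then within \<open>3 * r\<close> of each other, and the angles
  within \<open>6 * r\<close>. Capping at \<open>pi\<close> gives the full circle, whose square is
  the whole disc.\<close>

lemma kernel_small_imp_carleson_square:
  assumes a: "norm a < 1" and w: "norm w < 1" and r: "norm (1 - cnj a * w) < r"
  defines "h \<equiv> min pi (6 * r)"
  shows "w \<in> carleson_square {Arg a - h..Arg a + h}"
proof -
  \<comment> \<open>The angle of \<open>w\<close> relative to \<open>a\<close>, reduced to the range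
    of \<open>Arg\<close>. Only polar forms are used below, so the default \<open>Arg 0 = 0\<close>
    covers \<open>a = 0\<close> and \<open>w = 0\<close>.\<close>
  define t where "t = Arg (w * cis (- Arg a))"
  have t: "\<bar>t\<bar> \<le> pi" using Arg_bounded[of "w * cis (- Arg a)"] by (auto simp: t_def)
  have r0: "0 < r" using r norm_ge_zero[of "1 - cnj a * w"] by linarith
  have h0: "0 < h" "h \<le> pi" using r0 by (auto simp: h_def)
  have "w * cis (- Arg a) = rcis (norm w) t"
    using rcis_cmod_Arg[of "w * cis (- Arg a)"] by (simp add: t_def norm_mult)
  then have "w = rcis (norm w) t * cis (Arg a)"
    by (metis (no_types) cis_mult cis_zero mult.assoc mult.right_neutral add.left_inverse)
  then have weq: "w = rcis (norm w) (Arg a + t)"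
    by (simp add: rcis_def cis_mult add.commute mult.assoc)
  have "norm (cis (Arg a + t) - cis (Arg a)) \<le> 3 * r"
  proof -
    have 1: "norm (cis (Arg a + t) - w) = 1 - norm w"
    proof -
      have "cis (Arg a + t) - w = of_real (1 - norm w) * cis (Arg a + t)"
        using weq by (simp add: rcis_def left_diff_distrib)
      then show ?thesis using w by (simp only: norm_mult norm_of_real norm_cis) simp
    qed
    have 2: "norm (a - cis (Arg a)) = 1 - norm a"
    proof -
      have "a - cis (Arg a) = of_real (norm a - 1) * cis (Arg a)"
        using rcis_cmod_Arg[of a] by (simp add: rcis_def left_diff_distrib)
      then show ?thesis using a by (simp only: norm_mult norm_of_real norm_cis) simp
    qed
    have "cis (Arg a + t) - cis (Arg a) = (cis (Arg a + t) - w) + (w - a) + (a - cis (Arg a))" by simp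
    also have "norm \<dots> \<le> (1 - norm w) + norm (w - a) + (1 - norm a)"
      using norm_triangle_ineq[of "(cis (Arg a + t) - w) + (w - a)" "a - cis (Arg a)"]
        norm_triangle_ineq[of "cis (Arg a + t) - w" "w - a"] 1 2 by linarith
    also have "\<dots> \<le> 3 * r"
      using norm_cnj_kernel_ge[of a w] a w r by linarith
    finally show ?thesis .
  qed
  also have "norm (cis (Arg a + t) - cis (Arg a)) = norm (cis (Arg a) * (cis t - 1))"
    by (simp add: cis_mult right_diff_distrib)
  also have "\<dots> = norm (cis t - 1)" by (simp add: norm_mult)
  finally have "norm (cis t - 1) \<le> 3 * r" .
  then have "\<bar>t\<bar> \<le> h" using abs_le_norm_cis_minus_1[OF t] t by (simp add: h_def)
  then have J: "Arg a + t \<in> {Arg a - h..Arg a + h}" by auto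
  have "1 - norm w \<le> h / pi"
  proof (cases "pi \<le> 6 * r")
    case True then show ?thesis by (simp add: h_def)
  next
    case False
    have "1 - norm w \<le> r" using norm_cnj_kernel_ge(3)[of a w] a w r by linarith
    also have "r \<le> 6 * r / pi" using pi_less_4 r0 by (simp add: field_simps)
    finally show ?thesis using False by (simp add: h_def)
  qed
  then have "1 - arc_length {Arg a - h..Arg a + h} \<le> norm w"
    using arc_angles_symmetric(2)[OF h0] by simp
  then show ?thesis
    unfolding carleson_square_def using weq w J by blast
qed

text \<open>The supremum over arcs becomes a bound on the mass of every kernel ball; with finite
  \<open>S\<close> no summability has to be known beforehand. The arc attached to a ball of radius
  \<open>r\<close> has length at most \<open>6 * r / pi \<le> 2 * r\<close>, hence
  \<open>2 powr p\<close>; adding 1 to the supremum \<open>k\<close> makes the constant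
  positive.\<close>

lemma carleson_dirac_sum_le:
  assumes z: "\<And>n. n \<in> N \<Longrightarrow> z n \<in> unit_disc"
    and C: "carleson_measure p (dirac_sum N w z)" and w: "\<And>n. 0 \<le> w n" and p: "0 < p"
  obtains M where "0 < M"
    "\<And>S a r. finite S \<Longrightarrow> S \<subseteq> N \<Longrightarrow> norm a < 1 \<Longrightarrow> 0 < r \<Longrightarrow>
       (\<Sum>n | n \<in> S \<and> norm (1 - cnj a * z n) < r. w n) \<le> M * r powr p"
proof -
  define K where "K = (SUP J\<in>arc_angles. emeasure (dirac_sum N w z) (carleson_square J) / ennreal (arc_length J powr p))"
  have "K < \<infinity>" using C by (simp add: K_def carleson_measure_def)
  then obtain k where k: "K = ennreal k" "0 \<le> k" by (cases K) auto
  show thesis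
  proof (rule that[of "(k + 1) * 2 powr p"])
    show "0 < (k + 1) * 2 powr p" using k by simp
    fix S a r assume S: "finite S" "S \<subseteq> N" and a: "norm (a::complex) < 1" and r: "0 < (r::real)"
    define h where "h = min pi (6 * r)"
    define J where "J = {Arg a - h..Arg a + h}"
    have h: "0 < h" "h \<le> pi" using r by (auto simp: h_def)
    have J: "J \<in> arc_angles" "arc_length J = h / pi" "compact J"
      using arc_angles_symmetric[OF h] by (auto simp: J_def)
    define S' where "S' = {n \<in> S. norm (1 - cnj a * z n) < r}"
    have S': "finite S'" "S' \<subseteq> N" using S by (auto simp: S'_def)
    have Q: "carleson_square J \<in> sets (restrict_space borel unit_disc)"
      using carleson_square_borel[of J] J h by simp
    have inQ: "z n \<in> carleson_square J" if "n \<in> S'" for n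
      unfolding J_def h_def
      by (rule kernel_small_imp_carleson_square) (use that S z a in \<open>auto simp: S'_def\<close>)
    have "ennreal (\<Sum>n\<in>S'. w n) = (\<integral>\<^sup>+ n. ennreal (w n) * indicator S' n \<partial>count_space UNIV)"
      using S' w by (simp add: nn_integral_count_space_finite sum_ennreal flip: nn_integral_count_space_indicator)
    also have "\<dots> \<le> (\<integral>\<^sup>+ n. ennreal (w n) * indicator (carleson_square J) (z n) * indicator N n \<partial>count_space UNIV)"
      using S' inQ by (intro nn_integral_mono) (auto simp: indicator_def)
    also have "\<dots> = (\<integral>\<^sup>+ n. ennreal (w n) * indicator (carleson_square J) (z n) \<partial>count_space N)"
      by (simp flip: nn_integral_count_space_indicator)
    also have "\<dots> = emeasure (dirac_sum N w z) (carleson_square J)"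
      by (rule emeasure_dirac_sum[symmetric]) (use z Q in auto)
    finally have le: "ennreal (\<Sum>n\<in>S'. w n) \<le> emeasure (dirac_sum N w z) (carleson_square J)" .
    have pos: "0 < arc_length J powr p" using J h by simp
    have "ennreal ((\<Sum>n\<in>S'. w n) / arc_length J powr p) = ennreal (\<Sum>n\<in>S'. w n) / ennreal (arc_length J powr p)"
      using pos w by (simp add: divide_ennreal sum_nonneg)
    also have "\<dots> \<le> emeasure (dirac_sum N w z) (carleson_square J) / ennreal (arc_length J powr p)"
      by (rule divide_right_mono_ennreal[OF le])
    also have "\<dots> \<le> ennreal k"
      unfolding k(1)[symmetric] K_def by (rule SUP_upper[OF J(1)])
    finally have "(\<Sum>n\<in>S'. w n) / arc_length J powr p \<le> k"
      using k(2) by (simp add: ennreal_le_iff)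
    then have "(\<Sum>n\<in>S'. w n) \<le> k * arc_length J powr p"
      using pos by (simp add: field_simps)
    also have "\<dots> \<le> (k + 1) * (2 * r) powr p"
    proof (intro mult_mono powr_mono2)
      have "h / pi \<le> 6 * r / pi" by (intro divide_right_mono) (auto simp: h_def)
      also have "\<dots> \<le> 2 * r" using pi_gt3 r by (simp add: field_simps)
      finally show "arc_length J \<le> 2 * r" using J by simp
    qed (use k p J h in auto)
    also have "\<dots> = (k + 1) * 2 powr p * r powr p" using r by (simp add: powr_mult)
    finally show "(\<Sum>n | n \<in> S \<and> norm (1 - cnj a * z n) < r. w n) \<le> (k + 1) * 2 powr p * r powr p"
      by (simp add: S'_def)
  qed
qed

text \<open>
  The dyadic shells on which the kernel is comparable to \<open>2 ^ k * (1 - norm a)\<close> contribute a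
  geometric series.
\<close>

lemma dyadic_kernel_sum_le:
  fixes z :: "nat \<Rightarrow> complex" and x :: "nat \<Rightarrow> real"
  assumes S: "finite S" "\<And>n. n \<in> S \<Longrightarrow> norm (z n) < 1" and a: "norm a < 1" and x: "\<And>n. 0 \<le> x n"
    and p: "0 < p" "p \<le> 1" and M: "0 \<le> M"
    and le: "\<And>r. 0 < r \<Longrightarrow> (\<Sum>n | n \<in> S \<and> norm (1 - cnj a * z n) < r. x n) \<le> M * r powr p"
  shows "(\<Sum>n\<in>S. x n / norm (1 - cnj a * z n) powr (p + 1)) \<le> 4 * M / (1 - norm a)"
proof -
  define d where "d = 1 - norm a"
  have d: "0 < d" using a by (simp add: d_def)
  define \<psi> where "\<psi> n = norm (1 - cnj a * z n)" for n
  have \<psi>: "d \<le> \<psi> n" "\<psi> n \<le> 2" if "n \<in> S" for n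
    using norm_cnj_kernel_ge[of a "z n"] a S(2)[OF that] by (auto simp: d_def \<psi>_def)
  \<comment> \<open>Kernel values never exceed 2, so \<open>K\<close> shells starting at radius
    \<open>d\<close> catch all the points.\<close>
  obtain K where K: "2 < 2 ^ K * d"
    using real_arch_pow[of 2 "2 / d"] d by (auto simp: field_simps)
  have shell: "1 / \<psi> n powr (p + 1) \<le> (\<Sum>k<K. (2 ^ k * d) powr (- (p + 1)) * of_bool (\<psi> n < 2 ^ Suc k * d))"
    if n: "n \<in> S" for n
  proof -
    define k where "k = (LEAST k. \<psi> n < 2 ^ Suc k * d)"
    have ex: "\<psi> n < 2 ^ Suc K * d" using \<psi>(2)[OF n] K d by simp
    have k: "\<psi> n < 2 ^ Suc k * d" unfolding k_def by (rule LeastI[of _ K]) (rule ex)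
    have "2 ^ k * d \<le> \<psi> n"
    proof (cases k)
      case 0 then show ?thesis using \<psi>(1)[OF n] by simp
    next
      case (Suc j)
      then have "\<not> \<psi> n < 2 ^ Suc j * d" using not_less_Least[of j "\<lambda>k. \<psi> n < 2 ^ Suc k * d"]
        unfolding k_def by auto
      then show ?thesis using Suc by simp
    qed
    note k2 = this
    have "k < K"
    proof (rule ccontr)
      assume "\<not> k < K"
      then have "(2::real) ^ K * d \<le> 2 ^ k * d" using d by (intro mult_right_mono power_increasing) auto
      then show False using K k2 \<psi>(2)[OF n] by linarith
    qed
    have "1 / \<psi> n powr (p + 1) = \<psi> n powr (- (p + 1))" by (simp only: powr_minus_divide)
    also have "\<dots> \<le> (2 ^ k * d) powr (- (p + 1)) * of_bool (\<psi> n < 2 ^ Suc k * d)"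
      using k k2 p d by (auto intro!: powr_mono2')
    also have "\<dots> \<le> (\<Sum>k<K. (2 ^ k * d) powr (- (p + 1)) * of_bool (\<psi> n < 2 ^ Suc k * d))"
      using \<open>k < K\<close> by (intro member_le_sum) auto
    finally show ?thesis .
  qed
  have "(\<Sum>n\<in>S. x n / \<psi> n powr (p + 1)) \<le>
     (\<Sum>n\<in>S. x n * (\<Sum>k<K. (2 ^ k * d) powr (- (p + 1)) * of_bool (\<psi> n < 2 ^ Suc k * d)))"
    using mult_left_mono[OF shell x] by (intro sum_mono) (auto simp: field_simps)
  also have "\<dots> = (\<Sum>k<K. (2 ^ k * d) powr (- (p + 1)) * (\<Sum>n\<in>S. x n * of_bool (\<psi> n < 2 ^ Suc k * d)))"
    unfolding sum_distrib_left by (subst sum.swap) (simp add: mult_ac)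
  also have "\<dots> = (\<Sum>k<K. (2 ^ k * d) powr (- (p + 1)) * (\<Sum>n | n \<in> S \<and> \<psi> n < 2 ^ Suc k * d. x n))"
    using S(1) by (intro sum.cong refl arg_cong2[where f="(*)"] sum.mono_neutral_cong_right) auto
  also have "\<dots> \<le> (\<Sum>k<K. (2 ^ k * d) powr (- (p + 1)) * (M * (2 ^ Suc k * d) powr p))"
    using d le unfolding \<psi>_def by (intro sum_mono mult_left_mono) auto
  also have "\<dots> \<le> (\<Sum>k<K. 2 * M / d * (1 / 2) ^ k)"
  proof (intro sum_mono)
    fix k
    \<comment> \<open>The exponents leave \<open>1 / (2 ^ k * d)\<close>, a geometric series of
      ratio 1/2 in \<open>k\<close>; \<open>2 powr p \<le> 2\<close> and the sum of that series make
      up the factor 4.\<close>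
    have "(2 ^ k * d) powr (- (p + 1)) * (M * (2 ^ Suc k * d) powr p) =
       M * 2 powr p * ((2 ^ k * d) powr (- (p + 1)) * (2 ^ k * d) powr p)"
      using d by (simp add: powr_mult mult_ac)
    also have "(2 ^ k * d) powr (- (p + 1)) * (2 ^ k * d) powr p = (2 ^ k * d) powr (-1)"
      by (subst powr_add[symmetric]) simp
    also have "\<dots> = 1 / (2 ^ k * d)" using d by (simp add: powr_minus_divide)
    also have "M * 2 powr p * (1 / (2 ^ k * d)) \<le> M * 2 powr 1 * (1 / (2 ^ k * d))"
      using p d M by (intro mult_right_mono mult_left_mono powr_mono) auto
    finally show "(2 ^ k * d) powr (- (p + 1)) * (M * (2 ^ Suc k * d) powr p) \<le> 2 * M / d * (1 / 2) ^ k"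
      by (simp add: field_simps)
  qed
  also have "\<dots> = 2 * M / d * (\<Sum>k<K. (1 / 2) ^ k)" by (simp add: sum_distrib_left)
  also have "\<dots> \<le> 2 * M / d * 2"
  proof (rule mult_left_mono)
    have "(\<Sum>k<K. (1 / 2 :: real) ^ k) \<le> (\<Sum>k. (1 / 2) ^ k)"
      by (intro sum_le_suminf summable_geometric) auto
    then show "(\<Sum>k<K. (1 / 2 :: real) ^ k) \<le> 2" by (simp add: suminf_geometric)
  qed (use M d in auto)
  finally show ?thesis by (simp add: \<psi>_def d_def)
qed

section \<open>Interpolation\<close>

lemma compact_subset_unit_disc:
  assumes "compact K" "K \<subseteq> unit_disc"
  obtains r where "0 < r" "r < 1" "K \<subseteq> cball 0 r"
proof (cases "K = {}")
  case True
  then show thesis by (intro that[of "1/2"]) auto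
next
  case False
  obtain x where x: "x \<in> K" "\<And>y. y \<in> K \<Longrightarrow> norm y \<le> norm x"
    using continuous_attains_sup[OF assms(1) False, of norm] continuous_on_norm_id by blast
  have "norm x < 1" using x(1) assms(2) by auto
  then show thesis
    by (intro that[of "max (1/2) (norm x)"]) (use x(2) in \<open>auto simp: le_max_iff_disj\<close>)
qed

text \<open>The unimodular normalization is left out: only zeros, moduli, and quotients of one
  product at two points occur, and this form also covers \<open>a = 0\<close>.\<close>

definition blaschke :: "complex \<Rightarrow> complex \<Rightarrow> complex" where
  "blaschke a w = (w - a) / (1 - cnj a * w)"

lemma norm_blaschke_le:
  assumes "norm a < 1" "norm w \<le> 1" shows "norm (blaschke a w) \<le> 1"
  using norm_cnj_kernel_ge(1,4)[OF assms] by (simp add: blaschke_def norm_divide)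

lemma cnj_kernel_nonzero: "norm a < 1 \<Longrightarrow> norm w \<le> 1 \<Longrightarrow> 1 - cnj a * w \<noteq> 0"
  using norm_cnj_kernel_ge(4)[of a w] by auto

lemma blaschke_holomorphic [holomorphic_intros]:
  assumes "norm a < 1" shows "blaschke a holomorphic_on unit_disc"
  unfolding blaschke_def[abs_def] using assms
  by (auto intro!: holomorphic_intros dest!: cnj_kernel_nonzero[OF assms less_imp_le])

text \<open>With \<open>x\<close> the squared modulus, \<open>- ln x \<le> 1 / x - 1 = (1 - x) / x
  \<le> (1 - x) / \<delta> ^ 2\<close>, and \<open>1 - x\<close> is the quotient in the exponent.
  Lower bounds for Blaschke products thereby reduce to upper bounds for sums of kernels.\<close>

lemma exp_le_norm_blaschke_sq:
  assumes a: "norm a < 1" and w: "norm w < 1" and \<delta>: "0 < \<delta>" "\<delta> \<le> norm (blaschke a w)"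
  shows "exp (- ((1 - (norm a)\<^sup>2) * (1 - (norm w)\<^sup>2) / (norm (1 - cnj a * w))\<^sup>2) / \<delta>\<^sup>2) \<le> (norm (blaschke a w))\<^sup>2"
proof -
  define x where "x = (norm (blaschke a w))\<^sup>2"
  have X: "0 < norm (1 - cnj a * w)" using norm_cnj_kernel_ge(4)[of a w] a w by simp
  have x: "1 - x = (1 - (norm a)\<^sup>2) * (1 - (norm w)\<^sup>2) / (norm (1 - cnj a * w))\<^sup>2"
    unfolding x_def blaschke_def norm_divide power_divide
    using norm_one_minus_cnj_mult_sq[of a w] X by (simp add: field_simps)
  have x\<delta>: "\<delta>\<^sup>2 \<le> x" using \<delta> by (simp add: x_def power_mono)
  have "0 < \<delta>\<^sup>2" using \<delta> by simp
  then have x0: "0 < x" using x\<delta> by linarith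
  have x1: "0 \<le> 1 - x" unfolding x using a w by (auto intro!: divide_nonneg_nonneg mult_nonneg_nonneg simp: power_le_one)
  have "- ln x \<le> 1 / x - 1"
    using ln_le_minus_one[of "1 / x"] x0 by (simp add: ln_div)
  also have "\<dots> = (1 - x) / x" using x0 by (simp add: field_simps)
  also have "\<dots> \<le> (1 - x) / \<delta>\<^sup>2" using x1 x\<delta> \<delta> by (intro divide_left_mono) (auto simp: x0)
  finally have "- ((1 - x) / \<delta>\<^sup>2) \<le> ln x" by simp
  then have "exp (- ((1 - x) / \<delta>\<^sup>2)) \<le> x"
    using x0 by (metis exp_le_cancel_iff exp_ln)
  then show ?thesis unfolding x[symmetric] by (simp only: x_def minus_divide_left)
qed

text \<open>The form in which the hypotheses enter the construction. The Carleson condition becomes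
  the test-function bound \<open>kernel_sum\<close>, uniform over finite subsets; separation is free
  of quotients, and \<open>\<delta> \<le> 1\<close> lets \<open>\<delta>\<close> scale
  radii.\<close>

locale carleson_points =
  fixes p :: real and N :: "nat set" and z :: "nat \<Rightarrow> complex" and \<delta> M :: real
  assumes p_pos: "0 < p" and p_le_1: "p \<le> 1"
    and norm_z: "\<And>n. n \<in> N \<Longrightarrow> norm (z n) < 1"
    and \<delta>_pos: "0 < \<delta>" and \<delta>_le: "\<delta> \<le> 1"
    and separated: "\<And>n k. n \<in> N \<Longrightarrow> k \<in> N \<Longrightarrow> n \<noteq> k \<Longrightarrow> \<delta> * norm (1 - cnj (z n) * z k) \<le> norm (z n - z k)"
    and M_pos: "0 < M"
    and kernel_sum: "\<And>S a. finite S \<Longrightarrow> S \<subseteq> N \<Longrightarrow> norm a < 1 \<Longrightarrow>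
      (\<Sum>n\<in>S. (1 - norm (z n)) powr p / norm (1 - cnj a * z n) powr (p + 1)) \<le> M / (1 - norm a)"
begin

text \<open>Since \<open>1 - norm (z n)\<close> is at most the kernel and
  \<open>m \<ge> 1 \<ge> p\<close>, raising both exponents by \<open>m - p\<close> can only decrease
  a term. The case \<open>m = 1\<close> serves the Blaschke products, \<open>m = 2\<close> the
  kernel \<open>K\<close>.\<close>

lemma kernel_sum_general:
  assumes S: "finite S" "S \<subseteq> N" and a: "norm a < 1" and m: "1 \<le> m"
  shows "(\<Sum>n\<in>S. (1 - norm (z n)) ^ m / norm (1 - cnj (z n) * a) ^ Suc m) \<le> M / (1 - norm a)"
proof -
  have "(\<Sum>n\<in>S. (1 - norm (z n)) ^ m / norm (1 - cnj (z n) * a) ^ Suc m) \<le>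
        (\<Sum>n\<in>S. (1 - norm (z n)) powr p / norm (1 - cnj a * z n) powr (p + 1))"
  proof (rule sum_mono)
    fix n assume "n \<in> S"
    then have n: "norm (z n) < 1" using S norm_z by auto
    define d where "d = 1 - norm (z n)"
    define X where "X = norm (1 - cnj a * z n)"
    have dX: "0 < d" "d \<le> X" using n a norm_cnj_kernel_ge(3)[of a "z n"] by (auto simp: d_def X_def)
    have "d powr (real m - p) \<le> X powr (real m - p)"
      using dX m p_le_1 by (intro powr_mono2) auto
    then have "d powr p * d powr (real m - p) * X powr (p + 1) \<le> d powr p * X powr (real m - p) * X powr (p + 1)"
      by (intro mult_right_mono mult_left_mono) auto
    moreover have "d powr p * d powr (real m - p) = d ^ m"
      using dX by (simp add: powr_add[symmetric] powr_realpow)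
    moreover have "X powr (real m - p) * X powr (p + 1) = X powr real (Suc m)"
      by (simp add: powr_add[symmetric] add.commute)
    moreover have "X powr real (Suc m) = X ^ Suc m"
      using dX by (intro powr_realpow) auto
    ultimately have "d ^ m * X powr (p + 1) \<le> d powr p * X ^ Suc m"
      by (metis mult.assoc)
    then have "d ^ m / X ^ Suc m \<le> d powr p / X powr (p + 1)"
      using dX by (simp add: divide_simps mult_ac)
    then show "(1 - norm (z n)) ^ m / norm (1 - cnj (z n) * a) ^ Suc m \<le>
      (1 - norm (z n)) powr p / norm (1 - cnj a * z n) powr (p + 1)"
      unfolding d_def X_def by (simp add: norm_cnj_kernel_commute[of a])
  qed
  also have "\<dots> \<le> M / (1 - norm a)" by (rule kernel_sum[OF S a])
  finally show ?thesis .
qed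

text \<open>Zero outside \<open>N\<close>, so that finite and infinite sequences give the same kind
  of series over all naturals.\<close>

definition \<kappa> :: "nat \<Rightarrow> complex \<Rightarrow> real" where
  "\<kappa> n w = (if n \<in> N then (1 - norm (z n))\<^sup>2 / norm (1 - cnj (z n) * w) ^ 3 else 0)"

definition K :: "complex \<Rightarrow> real" where "K w = (\<Sum>n. \<kappa> n w)"

lemma \<kappa>_nonneg: "0 \<le> \<kappa> n w" by (simp add: \<kappa>_def)

lemma sum_\<kappa>_le:
  assumes "finite S" "norm w < 1" shows "(\<Sum>n\<in>S. \<kappa> n w) \<le> M / (1 - norm w)"
proof -
  have "(\<Sum>n\<in>S. \<kappa> n w) = (\<Sum>n\<in>S \<inter> N. (1 - norm (z n)) ^ 2 / norm (1 - cnj (z n) * w) ^ Suc 2)"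
    using assms(1) by (intro sum.mono_neutral_cong_right) (auto simp: \<kappa>_def numeral_3_eq_3 numeral_2_eq_2)
  also have "\<dots> \<le> M / (1 - norm w)" using assms by (intro kernel_sum_general) auto
  finally show ?thesis .
qed

lemma summable_\<kappa>: "norm w < 1 \<Longrightarrow> summable (\<lambda>n. \<kappa> n w)"
  by (rule summableI_nonneg_bounded[where x="M / (1 - norm w)"]) (auto simp: \<kappa>_nonneg intro: sum_\<kappa>_le)

lemma K_le: "norm w < 1 \<Longrightarrow> K w \<le> M / (1 - norm w)"
  unfolding K_def by (intro suminf_le_const summable_\<kappa>) (auto intro: sum_\<kappa>_le)

lemma sum_le_K: "finite S \<Longrightarrow> norm w < 1 \<Longrightarrow> (\<Sum>n\<in>S. \<kappa> n w) \<le> K w"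
  unfolding K_def by (intro sum_le_suminf summable_\<kappa>) (auto simp: \<kappa>_nonneg)

lemma K_nonneg: "norm w < 1 \<Longrightarrow> 0 \<le> K w"
  using sum_le_K[of "{}" w] by simp

text \<open>A Harnack inequality. The displacement is at most half of any kernel value at
  \<open>w\<close>, because \<open>1 - norm w\<close> is below all of them; so it at most halves
  that value, and the exponent 3 gives 8.\<close>

lemma K_comparable:
  assumes w: "norm w < 1" and x: "norm (x - w) \<le> (1 - norm w) / 2"
  shows "K x \<le> 8 * K w"
proof -
  have nx: "norm x < 1" using norm_triangle_ineq2[of x w] x w by (simp add: field_simps)
  have "\<kappa> n x \<le> 8 * \<kappa> n w" for n
  proof (cases "n \<in> N")
    case True
    note zn = norm_z[OF True]
    define X Y where "X = norm (1 - cnj (z n) * x)" and "Y = norm (1 - cnj (z n) * w)"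
    have Y: "0 < Y" "1 - norm w \<le> Y" using norm_cnj_kernel_ge[of "z n" w] zn w by (auto simp: Y_def)
    have X0: "0 < X" using norm_cnj_kernel_ge[of "z n" x] zn nx by (auto simp: X_def)
    have "1 - cnj (z n) * w = (1 - cnj (z n) * x) + cnj (z n) * (x - w)" by (simp add: algebra_simps)
    then have "Y \<le> X + norm (z n) * norm (x - w)"
      unfolding X_def Y_def by (metis norm_triangle_ineq norm_mult complex_mod_cnj)
    also have "norm (z n) * norm (x - w) \<le> norm (x - w)" using zn by (intro mult_left_le_one_le) auto
    finally have "Y \<le> X + norm (x - w)" by simp
    then have "Y \<le> 2 * X" using x Y by (simp add: field_simps)
    then have "Y ^ 3 \<le> (2 * X) ^ 3" using Y by (intro power_mono) auto
    then have "1 / X ^ 3 \<le> 8 / Y ^ 3" using X0 Y by (simp add: field_simps)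
    then have "(1 - norm (z n))\<^sup>2 * (1 / X ^ 3) \<le> (1 - norm (z n))\<^sup>2 * (8 / Y ^ 3)"
      by (intro mult_left_mono) auto
    then show ?thesis using True by (simp add: \<kappa>_def X_def Y_def mult.commute)
  qed (simp add: \<kappa>_def)
  then have "K x \<le> (\<Sum>n. 8 * \<kappa> n w)"
    unfolding K_def by (intro suminf_le summable_\<kappa> summable_mult nx w)
  also have "\<dots> = 8 * K w" unfolding K_def by (rule suminf_mult) (rule summable_\<kappa>[OF w])
  finally show ?thesis .
qed

definition \<eta> :: real where "\<eta> = exp (- (2 * M / \<delta>\<^sup>2))"

lemma \<eta>_pos: "0 < \<eta>" by (simp add: \<eta>_def)

lemma \<delta>_le_blaschke: "n \<in> N \<Longrightarrow> k \<in> N \<Longrightarrow> n \<noteq> k \<Longrightarrow> \<delta> \<le> norm (blaschke (z n) (z k))"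
  using separated[of n k] norm_cnj_kernel_ge(4)[of "z n" "z k"] norm_z[of n] norm_z[of k]
  by (simp add: blaschke_def norm_divide pos_le_divide_eq norm_minus_commute)

text \<open>\<open>t k\<close> is the defect \<open>1 - (norm (blaschke (z k) (z n))) ^ 2\<close>.
  The sum of the defects is at most \<open>4 * (1 - norm (z n))\<close> times a kernel sum at
  \<open>z n\<close>, whose bound \<open>M / (1 - norm (z n))\<close> cancels the first factor. The
  estimate concerns squared moduli, hence the exponent in \<open>\<eta>\<close> is half of
  \<open>4 * M / \<delta> ^ 2\<close>. Nothing depends on \<open>S\<close> or \<open>n\<close>: the
  points are uniformly separated.\<close>

lemma blaschke_prod_ge:
  assumes S: "finite S" "S \<subseteq> N" "n \<notin> S" and n: "n \<in> N"
  shows "\<eta> \<le> (\<Prod>k\<in>S. norm (blaschke (z k) (z n)))"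
proof -
  define t where "t k = (1 - (norm (z k))\<^sup>2) * (1 - (norm (z n))\<^sup>2) / (norm (1 - cnj (z k) * z n))\<^sup>2" for k
  have zn: "norm (z n) < 1" using norm_z n by blast
  have one_minus: "1 - (norm (z k))\<^sup>2 \<le> 2 * (1 - norm (z k))" if "k \<in> N" for k
    using norm_z[OF that] zero_le_power2[of "1 - norm (z k)"] by (simp add: power2_diff)
  have "(\<Sum>k\<in>S. t k) \<le> (\<Sum>k\<in>S. 4 * (1 - norm (z n)) * ((1 - norm (z k)) ^ 1 / norm (1 - cnj (z k) * z n) ^ Suc 1))"
  proof (rule sum_mono)
    fix k assume k: "k \<in> S"
    then have "(1 - (norm (z k))\<^sup>2) * (1 - (norm (z n))\<^sup>2) \<le> (2 * (1 - norm (z k))) * (2 * (1 - norm (z n)))"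
      using S n one_minus norm_z[of k] zn by (intro mult_mono) (auto simp: power_le_one)
    then have "t k \<le> (2 * (1 - norm (z k))) * (2 * (1 - norm (z n))) / (norm (1 - cnj (z k) * z n))\<^sup>2"
      unfolding t_def by (rule divide_right_mono) simp
    then show "t k \<le> 4 * (1 - norm (z n)) * ((1 - norm (z k)) ^ 1 / norm (1 - cnj (z k) * z n) ^ Suc 1)"
      by (simp add: power2_eq_square algebra_simps)
  qed
  also have "\<dots> \<le> 4 * (1 - norm (z n)) * (M / (1 - norm (z n)))"
    unfolding sum_distrib_left[symmetric] using S zn
    by (intro mult_left_mono kernel_sum_general) auto
  also have "\<dots> = 4 * M" using zn by (simp add: field_simps)
  finally have t4: "(\<Sum>k\<in>S. t k) \<le> 4 * M" .
  have "\<eta>\<^sup>2 = exp (- (4 * M / \<delta>\<^sup>2))" by (simp add: \<eta>_def power2_eq_square mult_exp_exp)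
  also have "\<dots> \<le> exp (\<Sum>k\<in>S. - t k / \<delta>\<^sup>2)"
    using t4 \<delta>_pos by (simp add: sum_negf sum_divide_distrib[symmetric] divide_right_mono)
  also have "\<dots> = (\<Prod>k\<in>S. exp (- t k / \<delta>\<^sup>2))" by (rule exp_sum[OF S(1)])
  also have "\<dots> \<le> (\<Prod>k\<in>S. (norm (blaschke (z k) (z n)))\<^sup>2)"
    using S n exp_le_norm_blaschke_sq[OF norm_z norm_z \<delta>_pos \<delta>_le_blaschke] unfolding t_def
    by (intro prod_mono conjI exp_ge_zero) blast
  also have "\<dots> = (\<Prod>k\<in>S. norm (blaschke (z k) (z n)))\<^sup>2" by (rule prod_power_distrib[symmetric])
  finally show ?thesis by (rule power2_le_imp_le) (auto intro: prod_nonneg)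
qed

text \<open>Term \<open>n\<close> is of Lagrange type: the quotient of Blaschke products vanishes at
  the other nodes, and \<open>u n\<close> equals 1 at \<open>z n\<close>. The cube of
  \<open>u n\<close> contributes \<open>8 * d ^ 3 / X ^ 3\<close>, the data cost
  \<open>C / d\<close> and the quotient at most \<open>1 / \<eta>\<close>, which leaves a multiple
  of \<open>\<kappa> n w\<close>. The constant is independent of the number of nodes, as the limit
  to infinitely many requires.\<close>

lemma finite_interpolation:
  assumes S: "finite S" "S \<subseteq> N" and c: "\<And>n. n \<in> N \<Longrightarrow> norm (c n) \<le> C / (1 - norm (z n))" and C: "0 \<le> C"
  obtains h where "h holomorphic_on unit_disc" "\<And>n. n \<in> S \<Longrightarrow> h (z n) = c n"
    "\<And>w. norm w < 1 \<Longrightarrow> norm (h w) \<le> 8 * C / \<eta> * K w"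
proof -
  define B where "B n w = (\<Prod>k\<in>S - {n}. blaschke (z k) w)" for n w
  define u where "u n w = complex_of_real (1 - (norm (z n))\<^sup>2) / (1 - cnj (z n) * w)" for n w
  define h where "h w = (\<Sum>n\<in>S. c n * (B n w / B n (z n)) * u n w ^ 3)" for w
  have zS: "norm (z n) < 1" if "n \<in> S" for n using that S norm_z by auto
  have B\<eta>: "\<eta> \<le> norm (B n (z n))" if "n \<in> S" for n
    unfolding B_def prod_norm[symmetric] using that S by (intro blaschke_prod_ge) auto
  have B1: "norm (B n w) \<le> 1" if "norm w < 1" for n w
    unfolding B_def prod_norm[symmetric] using that zS by (intro prod_le_1) (auto intro!: norm_blaschke_le)
  show thesis
  proof
    show "h holomorphic_on unit_disc"
    proof -
      have "B n holomorphic_on unit_disc" for n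
        unfolding B_def[abs_def] using zS by (intro holomorphic_intros) auto
      moreover have "u n holomorphic_on unit_disc" if "n \<in> S" for n
        unfolding u_def[abs_def] using zS[OF that]
        by (auto intro!: holomorphic_intros dest!: cnj_kernel_nonzero[OF zS[OF that] less_imp_le])
      ultimately show ?thesis
        unfolding h_def[abs_def] using B\<eta> \<eta>_pos by (intro holomorphic_intros) force+
    qed
  next
    fix m assume m: "m \<in> S"
    have "B n (z m) = 0" if "n \<in> S" "n \<noteq> m" for n
      unfolding B_def using that m S(1) by (intro prod_zero) (auto simp: blaschke_def)
    then have "h (z m) = (\<Sum>n\<in>S. if n = m then c n * (B n (z m) / B n (z n)) * u n (z m) ^ 3 else 0)"
      unfolding h_def by (intro sum.cong) auto
    also have "\<dots> = c m * (B m (z m) / B m (z m)) * u m (z m) ^ 3"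
      using m S(1) by simp
    also have "u m (z m) = 1"
    proof -
      have "1 - cnj (z m) * z m = complex_of_real (1 - (norm (z m))\<^sup>2)"
        by (simp add: complex_norm_square[symmetric] mult.commute[of "cnj _"] del: of_real_power)
      then show ?thesis unfolding u_def
        using cnj_kernel_nonzero[OF zS[OF m] less_imp_le[OF zS[OF m]]] by simp
    qed
    also have "B m (z m) / B m (z m) = 1" using B\<eta>[OF m] \<eta>_pos by auto
    finally show "h (z m) = c m" by simp
  next
    fix w :: complex assume w: "norm w < 1"
    have "norm (h w) \<le> (\<Sum>n\<in>S. norm (c n * (B n w / B n (z n)) * u n w ^ 3))"
      unfolding h_def by (rule norm_sum)
    also have "\<dots> \<le> (\<Sum>n\<in>S. 8 * C / \<eta> * \<kappa> n w)"
    proof (rule sum_mono)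
      fix n assume n: "n \<in> S"
      then have nN: "n \<in> N" using S by auto
      define d where "d = 1 - norm (z n)"
      have d: "0 < d" using zS[OF n] by (simp add: d_def)
      define X where "X = norm (1 - cnj (z n) * w)"
      have X: "0 < X" using norm_cnj_kernel_ge(4)[of "z n" w] zS[OF n] w by (simp add: X_def)
      have 1: "norm (c n) \<le> C / d" using c[OF nN] by (simp add: d_def)
      have 2: "norm (B n w / B n (z n)) \<le> 1 / \<eta>"
        unfolding norm_divide using B1[OF w] B\<eta>[OF n] \<eta>_pos by (intro frac_le) auto
      have 3: "norm (u n w) \<le> 2 * d / X"
      proof -
        have "1 - (norm (z n))\<^sup>2 = (1 - norm (z n)) * (1 + norm (z n))" by (simp add: power2_eq_square algebra_simps)
        also have "\<dots> \<le> d * 2" unfolding d_def using zS[OF n] by (intro mult_left_mono) auto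
        finally have "\<bar>1 - (norm (z n))\<^sup>2\<bar> \<le> 2 * d" using zS[OF n] by (simp add: power_le_one)
        then show ?thesis unfolding u_def norm_divide norm_of_real X_def[symmetric] using X
          by (intro divide_right_mono) auto
      qed
      have "norm (c n * (B n w / B n (z n)) * u n w ^ 3) \<le> (C / d) * (1 / \<eta>) * (2 * d / X) ^ 3"
        unfolding norm_mult norm_power using C d \<eta>_pos X
        by (intro mult_mono 1 2 power_mono 3) auto
      also have "\<dots> = 8 * C / \<eta> * \<kappa> n w"
        using nN d X by (simp add: \<kappa>_def d_def[symmetric] X_def[symmetric] power2_eq_square power3_eq_cube)
      finally show "norm (c n * (B n w / B n (z n)) * u n w ^ 3) \<le> 8 * C / \<eta> * \<kappa> n w" .
    qed
    also have "\<dots> \<le> 8 * C / \<eta> * K w"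
      unfolding sum_distrib_left[symmetric] using sum_le_K[OF S(1) w] C \<eta>_pos by (intro mult_left_mono) auto
    finally show "norm (h w) \<le> 8 * C / \<eta> * K w" .
  qed
qed

lemma interpolation:
  assumes c: "\<And>n. n \<in> N \<Longrightarrow> norm (c n) \<le> C / (1 - norm (z n))" and C: "0 \<le> C"
  obtains h where "h holomorphic_on unit_disc" "\<And>n. n \<in> N \<Longrightarrow> h (z n) = c n"
    "\<And>w. norm w < 1 \<Longrightarrow> norm (h w) \<le> 8 * C / \<eta> * K w"
proof -
  define C' where "C' = 8 * C / \<eta>"
  have C': "0 \<le> C'" using C \<eta>_pos by (simp add: C'_def)
  have "\<exists>h. h holomorphic_on unit_disc \<and> (\<forall>n\<in>N \<inter> {..<m}. h (z n) = c n) \<and>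
          (\<forall>w. norm w < 1 \<longrightarrow> norm (h w) \<le> C' * K w)" for m
    using finite_interpolation[of "N \<inter> {..<m}" c C] c C unfolding C'_def
    by (metis Int_lower1 finite_Int finite_lessThan)
  then obtain H where H: "\<And>m. H m holomorphic_on unit_disc" "\<And>m n. n \<in> N \<Longrightarrow> n < m \<Longrightarrow> H m (z n) = c n"
    "\<And>m w. norm w < 1 \<Longrightarrow> norm (H m w) \<le> C' * K w"
    by (metis Int_iff lessThan_iff)
  obtain g r where g: "g holomorphic_on unit_disc" "strict_mono (r :: nat \<Rightarrow> nat)"
    "\<And>x. x \<in> unit_disc \<Longrightarrow> (\<lambda>n. H (r n) x) \<longlonglongrightarrow> g x"
  proof (rule Montel[of unit_disc "range H" H])
    fix L :: "complex set" assume L: "compact L" "L \<subseteq> unit_disc"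
    obtain \<rho> where \<rho>: "\<rho> < 1" "L \<subseteq> cball 0 \<rho>" using compact_subset_unit_disc[OF L] by metis
    have "norm (H m w) \<le> C' * (M / (1 - \<rho>))" if "w \<in> L" for m w
    proof -
      have w: "norm w \<le> \<rho>" using that \<rho> by auto
      have "norm (H m w) \<le> C' * K w" using H(3) w \<rho> by auto
      also have "K w \<le> M / (1 - norm w)" using K_le w \<rho> by auto
      also have "\<dots> \<le> M / (1 - \<rho>)" using w \<rho> M_pos by (intro divide_left_mono) auto
      finally show ?thesis using C' by (simp add: mult_left_mono)
    qed
    then show "\<exists>B. \<forall>h\<in>range H. \<forall>w\<in>L. norm (h w) \<le> B" by blast
  qed (use H(1) in auto)
  show thesis
  proof
    show "g holomorphic_on unit_disc" by (rule g(1))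
  next
    fix n assume n: "n \<in> N"
    \<comment> \<open>A subsequence satisfies \<open>r m \<ge> m\<close>, so its members with
      \<open>m > n\<close> all interpolate at \<open>z n\<close>.\<close>
    have "\<forall>\<^sub>F m in sequentially. H (r m) (z n) = c n"
      using eventually_gt_at_top[of n]
    proof eventually_elim
      case (elim m)
      have "m \<le> r m" by (rule strict_mono_imp_increasing[OF g(2)])
      then show ?case using H(2)[OF n] elim by simp
    qed
    then have "(\<lambda>m. H (r m) (z n)) \<longlonglongrightarrow> c n" by (rule tendsto_eventually)
    moreover have "(\<lambda>m. H (r m) (z n)) \<longlonglongrightarrow> g (z n)" using g(3) norm_z[OF n] by simp
    ultimately show "g (z n) = c n" by (rule LIMSEQ_unique[symmetric])
  next
    fix w :: complex assume w: "norm w < 1"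
    have "(\<lambda>m. norm (H (r m) w)) \<longlonglongrightarrow> norm (g w)" using g(3) w by (intro tendsto_norm) simp
    then show "norm (g w) \<le> 8 * C / \<eta> * K w"
      by (rule LIMSEQ_le_const2) (use H(3)[OF w] in \<open>auto simp: C'_def\<close>)
  qed
qed

end

section \<open>The canonical product\<close>

lemma cnj_mult_self_complement: "1 - cnj a * a = complex_of_real (1 - (norm a)\<^sup>2)"
  by (simp add: complex_norm_square[symmetric] mult.commute[of "cnj _"] del: of_real_power)

text \<open>
  The variable is constantly \<open>1\<close> for \<open>a = 0\<close>, where its Weierstrass factor would vanish
  identically; hence the separate case in \<open>disc_factor\<close>.
\<close>

definition disc_var :: "complex \<Rightarrow> complex \<Rightarrow> complex" where
  "disc_var a w = complex_of_real (1 - (norm a)\<^sup>2) / (1 - cnj a * w)"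

definition disc_factor :: "complex \<Rightarrow> complex \<Rightarrow> complex" where
  "disc_factor a w = (if a = 0 then w else weierstrass_factor 1 (disc_var a w))"

text \<open>The factor divided by \<open>w - a\<close>, in a closed form that is visibly zero-free
  and holomorphic at \<open>w = a\<close>.\<close>

definition disc_cofactor :: "complex \<Rightarrow> complex \<Rightarrow> complex" where
  "disc_cofactor a w = (if a = 0 then 1 else - cnj a / (1 - cnj a * w) * exp (disc_var a w))"

text \<open>The logarithmic derivative of \<open>disc_factor a\<close>. That of a Blaschke factor
  has the first powers of \<open>1 - (norm a) ^ 2\<close> and \<open>1 - cnj a * w\<close>; the
  exponential raises both to squares. For \<open>a = 0\<close> it reads \<open>1 / w\<close>, in
  agreement with the special case.\<close>

definition disc_logderiv :: "complex \<Rightarrow> complex \<Rightarrow> complex" where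
  "disc_logderiv a w = complex_of_real ((1 - (norm a)\<^sup>2)\<^sup>2) / ((w - a) * (1 - cnj a * w)\<^sup>2)"

lemma disc_factor_eq:
  assumes "norm a < 1" "norm w \<le> 1"
  shows "disc_factor a w = (w - a) * disc_cofactor a w"
proof (cases "a = 0")
  case False
  have nz: "1 - cnj a * w \<noteq> 0" by (rule cnj_kernel_nonzero[OF assms])
  have "1 - disc_var a w = (w - a) * (- cnj a / (1 - cnj a * w))"
    unfolding disc_var_def cnj_mult_self_complement[symmetric] using nz
    by (simp add: divide_simps) (simp add: algebra_simps)
  then show ?thesis using False
    by (simp add: disc_factor_def disc_cofactor_def weierstrass_factor_def)
qed (simp add: disc_factor_def disc_cofactor_def)

lemma disc_cofactor_nonzero: "norm a < 1 \<Longrightarrow> norm w \<le> 1 \<Longrightarrow> disc_cofactor a w \<noteq> 0"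
  using cnj_kernel_nonzero[of a w] by (simp add: disc_cofactor_def)

lemma disc_factor_eq_0_iff: "norm a < 1 \<Longrightarrow> norm w \<le> 1 \<Longrightarrow> disc_factor a w = 0 \<longleftrightarrow> w = a"
  using disc_cofactor_nonzero[of a w] by (simp add: disc_factor_eq)

lemma disc_var_has_field_derivative:
  assumes "norm a < 1" "norm w < 1"
  shows "(disc_var a has_field_derivative (complex_of_real (1 - (norm a)\<^sup>2) * cnj a / (1 - cnj a * w)\<^sup>2)) (at w)"
  unfolding disc_var_def[abs_def] using cnj_kernel_nonzero[of a w] assms
  by (auto intro!: derivative_eq_intros simp: power2_eq_square)

lemma disc_cofactor_has_field_derivative:
  assumes "norm a < 1" "norm w < 1"
  shows "(disc_cofactor a has_field_derivative (disc_cofactor a w *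
    (cnj a / (1 - cnj a * w) + complex_of_real (1 - (norm a)\<^sup>2) * cnj a / (1 - cnj a * w)\<^sup>2))) (at w)"
proof (cases "a = 0")
  case False
  have nz: "1 - cnj a * w \<noteq> 0" using cnj_kernel_nonzero[of a w] assms by simp
  have "((\<lambda>w. - cnj a / (1 - cnj a * w) * exp (disc_var a w)) has_field_derivative
    (- cnj a / (1 - cnj a * w) * exp (disc_var a w)) *
    (cnj a / (1 - cnj a * w) + complex_of_real (1 - (norm a)\<^sup>2) * cnj a / (1 - cnj a * w)\<^sup>2)) (at w)"
    using nz
    by (auto intro!: derivative_eq_intros disc_var_has_field_derivative[OF assms])
       (simp add: divide_simps power2_eq_square, simp add: algebra_simps)
  then show ?thesis using False by (simp add: disc_cofactor_def[abs_def])
qed (simp add: disc_cofactor_def[abs_def])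

lemma disc_cofactor_holomorphic [holomorphic_intros]:
  "norm a < 1 \<Longrightarrow> disc_cofactor a holomorphic_on unit_disc"
  unfolding holomorphic_on_open[OF open_ball]
  by (metis disc_cofactor_has_field_derivative mem_ball_0)

lemma disc_factor_holomorphic [holomorphic_intros]:
  assumes "norm a < 1" shows "disc_factor a holomorphic_on unit_disc"
proof -
  have "(\<lambda>w. (w - a) * disc_cofactor a w) holomorphic_on unit_disc"
    by (intro holomorphic_intros assms)
  then show ?thesis by (rule holomorphic_transform) (use assms disc_factor_eq in auto)
qed

lemma disc_factor_logderiv:
  assumes "norm a < 1" "norm w < 1" "w \<noteq> a"
  shows "deriv (disc_factor a) w / disc_factor a w = disc_logderiv a w"
proof -
  have nz: "1 - cnj a * w \<noteq> 0" using cnj_kernel_nonzero[of a w] assms by simp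
  define D where "D = cnj a / (1 - cnj a * w) + complex_of_real (1 - (norm a)\<^sup>2) * cnj a / (1 - cnj a * w)\<^sup>2"
  have "((\<lambda>w. (w - a) * disc_cofactor a w) has_field_derivative
      (disc_cofactor a w + (w - a) * (disc_cofactor a w * D))) (at w)"
    unfolding D_def by (auto intro!: derivative_eq_intros disc_cofactor_has_field_derivative assms)
  then have "(disc_factor a has_field_derivative (disc_cofactor a w + (w - a) * (disc_cofactor a w * D))) (at w)"
    by (rule has_field_derivative_transform_within_open[of _ _ _ unit_disc])
       (use assms disc_factor_eq in auto)
  then have "deriv (disc_factor a) w / disc_factor a w =
     (disc_cofactor a w + (w - a) * (disc_cofactor a w * D)) / ((w - a) * disc_cofactor a w)"
    using assms by (simp add: DERIV_imp_deriv disc_factor_eq)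
  also have "\<dots> = 1 / (w - a) + D"
    using assms disc_cofactor_nonzero[of a w] by (simp add: field_simps)
  also have "\<dots> = disc_logderiv a w"
  proof -
    \<comment> \<open>\<open>t = X + c * Y\<close> is used twice: \<open>1 / Y\<close> and
      \<open>c / X\<close> add up to the Blaschke part \<open>t / (X * Y)\<close>, and the
      derivative \<open>t * c / X ^ 2\<close> of the exponent supplies a second factor
      \<open>t / X\<close>.\<close>
    have "1 / Y + (c / X + t * c / X\<^sup>2) = t\<^sup>2 / (Y * X\<^sup>2)" if "t = X + c * Y" "X \<noteq> 0" "Y \<noteq> 0" for X Y c t :: complex
      using that(2,3) unfolding that(1) by (simp add: field_simps power2_eq_square)
    from this[of "1 - cnj a * a" "1 - cnj a * w" "cnj a" "w - a"] nz assms(3)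
    show ?thesis
      unfolding D_def disc_logderiv_def of_real_power cnj_mult_self_complement[symmetric]
      by (simp add: right_diff_distrib)
  qed
  finally show ?thesis .
qed

lemma norm_disc_var_le:
  assumes "norm a < 1" "norm w \<le> R" "R < 1"
  shows "norm (disc_var a w) \<le> 2 * (1 - norm a) / (1 - R)"
proof -
  have X: "1 - R \<le> norm (1 - cnj a * w)"
    using norm_cnj_kernel_ge(3)[of a w] assms by simp
  have "1 - (norm a)\<^sup>2 = (1 - norm a) * (1 + norm a)" by (simp add: power2_eq_square algebra_simps)
  also have "\<dots> \<le> (1 - norm a) * 2" using assms by (intro mult_left_mono) auto
  finally have "\<bar>1 - (norm a)\<^sup>2\<bar> \<le> 2 * (1 - norm a)" using assms by (simp add: power_le_one)
  then show ?thesis unfolding disc_var_def norm_divide norm_of_real using X assms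
    by (intro frac_le) auto
qed

section \<open>The infinite product over a subset of the indices\<close>

context carleson_points
begin

text \<open>The index set is a parameter because the behaviour at a zero \<open>z n\<close> is read
  off from the product over \<open>N - {n}\<close>.\<close>

definition canonical_factor :: "nat set \<Rightarrow> nat \<Rightarrow> complex \<Rightarrow> complex" where
  "canonical_factor I n w = (if n \<in> I then disc_factor (z n) w else 1)"

definition canonical_product :: "nat set \<Rightarrow> complex \<Rightarrow> complex" where
  "canonical_product I w = (\<Prod>n. canonical_factor I n w)"

lemma canonical_factor_holomorphic:
  "I \<subseteq> N \<Longrightarrow> canonical_factor I n holomorphic_on unit_disc"
  using norm_z[of n] unfolding canonical_factor_def[abs_def]
  by (cases "n \<in> I") (auto intro: disc_factor_holomorphic)

text \<open>Since \<open>\<kappa> n 0\<close>, which is \<open>(1 - norm (z n)) ^ 2\<close> on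
  \<open>N\<close>, is summable, eventually \<open>1 - norm (z n) < (1 - R) / 4\<close> for
  \<open>n\<close> in \<open>N\<close>. This excludes \<open>z n = 0\<close> and bounds the variable
  by 1/2, where the Weierstrass factor differs from 1 by at most 3 times its square;
  \<open>12 = 3 * 2 ^ 2\<close>.\<close>

lemma canonical_factor_bound:
  assumes I: "I \<subseteq> N" and R: "0 \<le> R" "R < 1"
  shows "\<forall>\<^sub>F n in sequentially. \<forall>w\<in>cball 0 R.
    norm (norm (canonical_factor I n w - 1)) \<le> 12 / (1 - R)\<^sup>2 * \<kappa> n 0"
proof -
  have "(\<lambda>n. \<kappa> n 0) \<longlonglongrightarrow> 0"
    by (rule summable_LIMSEQ_zero) (simp add: summable_\<kappa>)
  moreover have "0 < ((1 - R) / 4)\<^sup>2" using R by simp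
  ultimately have "\<forall>\<^sub>F n in sequentially. \<kappa> n 0 < ((1 - R) / 4)\<^sup>2"
    by (rule order_tendstoD(2))
  then show ?thesis
  proof eventually_elim
    case (elim n)
    show ?case
    proof (cases "n \<in> I")
      case True
      then have n: "n \<in> N" using I by auto
      have \<kappa>: "\<kappa> n 0 = (1 - norm (z n))\<^sup>2" using n by (simp add: \<kappa>_def)
      have "1 - norm (z n) < (1 - R) / 4"
        by (rule power2_less_imp_less) (use elim \<kappa> R in auto)
      then have d: "1 - norm (z n) < (1 - R) / 4" "z n \<noteq> 0" using R by auto
      show ?thesis
      proof
        fix w :: complex assume w: "w \<in> cball 0 R"
        have u: "norm (disc_var (z n) w) \<le> 2 * (1 - norm (z n)) / (1 - R)"
          using norm_disc_var_le[OF norm_z[OF n]] w R by auto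
        also have "\<dots> \<le> 1 / 2" using d R by (simp add: field_simps)
        finally have "norm (weierstrass_factor 1 (disc_var (z n) w) - 1) \<le> 3 * norm (disc_var (z n) w) ^ Suc 1"
          by (rule weierstrass_factor_bound)
        also have "\<dots> \<le> 3 * (2 * (1 - norm (z n)) / (1 - R)) ^ Suc 1"
          using u by (intro mult_left_mono power_mono) auto
        also have "\<dots> = 12 / (1 - R)\<^sup>2 * \<kappa> n 0"
          unfolding \<kappa> power_divide power_mult_distrib by (simp flip: numeral_2_eq_2)
        finally show "norm (norm (canonical_factor I n w - 1)) \<le> 12 / (1 - R)\<^sup>2 * \<kappa> n 0"
          using True d by (simp add: canonical_factor_def disc_factor_def)
      qed
    qed (use R \<kappa>_nonneg in \<open>auto simp: canonical_factor_def\<close>)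
  qed
qed

lemma summable_canonical_bound: "summable (\<lambda>n. 12 / (1 - R)\<^sup>2 * \<kappa> n 0)"
  by (intro summable_mult summable_\<kappa>) simp

lemma canonical_factor_convergent:
  assumes I: "I \<subseteq> N" and w: "norm w < 1"
  shows "convergent_prod (\<lambda>n. canonical_factor I n w)"
proof -
  have "summable (\<lambda>n. norm (canonical_factor I n w - 1))"
    by (rule summable_comparison_test_ev[OF _ summable_canonical_bound[of "norm w"]])
       (use canonical_factor_bound[OF I _ w] in \<open>auto elim!: eventually_mono\<close>)
  then show ?thesis
    by (simp add: abs_convergent_prod_imp_convergent_prod abs_convergent_prod_conv_summable)
qed

lemma canonical_product_uniform_limit:
  assumes I: "I \<subseteq> N" and R: "0 \<le> R" "R < 1"
  shows "uniform_limit (cball 0 R) (\<lambda>m w. \<Prod>n<m. canonical_factor I n w) (canonical_product I) sequentially"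
proof -
  have "uniformly_convergent_on (cball 0 R) (\<lambda>m w. \<Prod>n<m. canonical_factor I n w)"
  proof (rule uniformly_convergent_on_prod')
    show "continuous_on (cball 0 R) (canonical_factor I n)" for n
      using canonical_factor_holomorphic[OF I, of n] R
      by (intro holomorphic_on_imp_continuous_on) (auto elim: holomorphic_on_subset)
    show "uniformly_convergent_on (cball 0 R) (\<lambda>m w. \<Sum>n<m. norm (canonical_factor I n w - 1))"
      by (rule Weierstrass_m_test'_ev[OF canonical_factor_bound[OF I R] summable_canonical_bound])
  qed simp
  then obtain g where g: "uniform_limit (cball 0 R) (\<lambda>m w. \<Prod>n<m. canonical_factor I n w) g sequentially"
    by (auto simp: uniformly_convergent_on_def)
  also have "?this \<longleftrightarrow> ?thesis"
  proof (intro uniform_limit_cong)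
    fix w :: complex assume w: "w \<in> cball 0 R"
    then have nw: "norm w < 1" using R by auto
    \<comment> \<open>Infinite products converge along \<open>{..m}\<close>, the uniform limit along
      \<open>{..<m}\<close>; the shift by one matches the two.\<close>
    have "(\<lambda>m. \<Prod>n<Suc m. canonical_factor I n w) \<longlonglongrightarrow> g w"
      using tendsto_uniform_limitI[OF g w] by (rule LIMSEQ_Suc)
    moreover have "(\<lambda>m. \<Prod>n<Suc m. canonical_factor I n w) \<longlonglongrightarrow> canonical_product I w"
      using convergent_prod_LIMSEQ[OF canonical_factor_convergent[OF I nw]]
      unfolding lessThan_Suc_atMost canonical_product_def .
    ultimately show "g w = canonical_product I w" by (rule LIMSEQ_unique)
  qed auto
  finally show ?thesis .
qed

lemma canonical_product_holomorphic:
  assumes I: "I \<subseteq> N" shows "canonical_product I holomorphic_on unit_disc"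
proof (rule holomorphic_uniform_sequence[of _ "\<lambda>m w. \<Prod>n<m. canonical_factor I n w"])
  show "(\<lambda>w. \<Prod>n<m. canonical_factor I n w) holomorphic_on unit_disc" for m
    by (intro holomorphic_intros canonical_factor_holomorphic I)
  fix w :: complex assume w: "w \<in> unit_disc"
  define d where "d = (1 - norm w) / 2"
  have d: "0 < d" "norm w + d < 1" using w by (auto simp: d_def field_simps)
  have sub: "cball w d \<subseteq> cball 0 (norm w + d)" by (simp add: cball_subset_cball_iff)
  have "uniform_limit (cball w d) (\<lambda>m w. \<Prod>n<m. canonical_factor I n w) (canonical_product I) sequentially"
    by (rule uniform_limit_on_subset[OF canonical_product_uniform_limit[OF I _ d(2)] sub]) (use d in auto)
  moreover have "cball w d \<subseteq> unit_disc" using sub d by (auto simp: subset_iff)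
  ultimately show "\<exists>d>0. cball w d \<subseteq> unit_disc \<and>
      uniform_limit (cball w d) (\<lambda>m w. \<Prod>n<m. canonical_factor I n w) (canonical_product I) sequentially"
    using d by blast
qed simp

lemma canonical_product_eq_0_iff:
  assumes I: "I \<subseteq> N" and w: "norm w < 1"
  shows "canonical_product I w = 0 \<longleftrightarrow> w \<in> z ` I"
proof -
  have "(\<lambda>n. canonical_factor I n w) has_prod canonical_product I w"
    unfolding canonical_product_def using canonical_factor_convergent[OF I w] by (rule convergent_prod_has_prod)
  then have "canonical_product I w = 0 \<longleftrightarrow> (\<exists>n. canonical_factor I n w = 0)"
    by (metis has_prod_eq_0_iff rangeE rangeI)
  also have "\<dots> \<longleftrightarrow> (\<exists>n\<in>I. disc_factor (z n) w = 0)"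
    by (auto simp: canonical_factor_def)
  also have "\<dots> \<longleftrightarrow> (\<exists>n\<in>I. w = z n)"
    using I w norm_z by (intro bex_cong refl disc_factor_eq_0_iff) auto
  also have "\<dots> \<longleftrightarrow> w \<in> z ` I" by auto
  finally show ?thesis .
qed

lemma canonical_product_logderiv:
  assumes I: "I \<subseteq> N" and w: "norm w < 1" "w \<notin> z ` I"
  shows "(\<lambda>n. if n \<in> I then disc_logderiv (z n) w else 0) sums
           (deriv (canonical_product I) w / canonical_product I w)"
proof -
  define R where "R = (1 + norm w) / 2"
  have R: "norm w < R" "0 \<le> R" "R < 1" using w by (auto simp: R_def field_simps)
  have "(\<lambda>n. deriv (canonical_factor I n) w / canonical_factor I n w) sums
           (deriv (canonical_product I) w / canonical_product I w)"
  proof (rule logderiv_prodinf_complex_uniform_limit[where A="ball 0 R"])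
    show "uniform_limit (ball 0 R) (\<lambda>m w. \<Prod>n<m. canonical_factor I n w) (canonical_product I) sequentially"
      by (rule uniform_limit_on_subset[OF canonical_product_uniform_limit[OF I R(2,3)]]) auto
    show "canonical_factor I n holomorphic_on ball 0 R" for n
      by (rule holomorphic_on_subset[OF canonical_factor_holomorphic[OF I]]) (use R in auto)
  qed (use R w canonical_product_eq_0_iff[OF I] in auto)
  moreover have "deriv (canonical_factor I n) w / canonical_factor I n w =
        (if n \<in> I then disc_logderiv (z n) w else 0)" for n
  proof (cases "n \<in> I")
    case True
    then have "canonical_factor I n = disc_factor (z n)" by (auto simp: canonical_factor_def)
    moreover have "w \<noteq> z n" "norm (z n) < 1" using True w I norm_z by auto
    ultimately show ?thesis using True disc_factor_logderiv[of "z n" w] w by simp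
  qed (simp add: canonical_factor_def[abs_def])
  ultimately show ?thesis by simp
qed

lemma canonical_product_remove:
  assumes I: "I \<subseteq> N" and n: "n \<in> I" and w: "norm w < 1"
  shows "canonical_product I w = disc_factor (z n) w * canonical_product (I - {n}) w"
proof -
  have single: "(\<lambda>k. if k = n then disc_factor (z n) w else 1) has_prod disc_factor (z n) w"
    by (rule has_prod_single)
  have "convergent_prod (\<lambda>k. canonical_factor (I - {n}) k w)"
    using I by (intro canonical_factor_convergent w) auto
  then have "(\<Prod>k. (if k = n then disc_factor (z n) w else 1) * canonical_factor (I - {n}) k w) =
     (\<Prod>k. if k = n then disc_factor (z n) w else 1) * (\<Prod>k. canonical_factor (I - {n}) k w)"
    using single by (intro prodinf_mult[symmetric]) (auto simp only: has_prod_iff)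
  moreover have "(\<Prod>k. if k = n then disc_factor (z n) w else 1) = disc_factor (z n) w"
    by (rule has_prod_unique[OF single, symmetric])
  moreover have "(if k = n then disc_factor (z n) w else 1) * canonical_factor (I - {n}) k w = canonical_factor I k w" for k
    using n by (auto simp: canonical_factor_def)
  ultimately show ?thesis by (simp add: canonical_product_def)
qed

end

section \<open>The solution and its logarithmic derivative\<close>

text \<open>At a zero of \<open>f\<close> the quotient has the finite limit
  \<open>deriv q w / deriv f w\<close> by l'Hopital's rule, so the singularity is removable. The
  identity holds at such points because both sides vanish.\<close>

lemma removable_quotient_at_simple_zeros:
  assumes f: "f holomorphic_on S" and q: "q holomorphic_on S" and S: "open S" "connected S"
    and nz: "\<exists>w\<in>S. f w \<noteq> 0"
    and zero: "\<And>w. w \<in> S \<Longrightarrow> f w = 0 \<Longrightarrow> q w = 0 \<and> deriv f w \<noteq> 0"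
  obtains A where "A holomorphic_on S" "\<And>w. w \<in> S \<Longrightarrow> q w = A w * f w"
proof
  define A where "A = remove_sings (\<lambda>w. q w / f w)"
  have ana: "f analytic_on {w}" "q analytic_on {w}" if "w \<in> S" for w
    using that f q S(1) by (auto intro: holomorphic_on_imp_analytic_at)
  show "A holomorphic_on S"
  proof -
    have "A analytic_on {w}" if w: "w \<in> S" for w
    proof (cases "f w = 0")
      case False
      then show ?thesis
        unfolding A_def using ana[OF w] by (intro remove_sings_analytic_on analytic_on_divide) auto
    next
      case True
      have "isolated_singularity_at (\<lambda>w. q w / f w) w"
        using ana[OF w]
        by (intro isolated_singularity_at_divide isolated_singularity_at_analytic not_essential_analytic) auto
      moreover have "((\<lambda>x. q x / f x) \<longlongrightarrow> deriv q w / deriv f w) (at w)"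
        using zero[OF w True] True w f q S(1)
        by (intro lhopital_complex_simple[of q "deriv q w" w f "deriv f w"] holomorphic_derivI[of _ S]) auto
      ultimately show ?thesis
        unfolding A_def by (rule remove_sings_analytic_at)
    qed
    then have "A analytic_on S" using analytic_on_analytic_at by blast
    then show ?thesis by (rule analytic_imp_holomorphic)
  qed
  fix w assume w: "w \<in> S"
  show "q w = A w * f w"
  proof (cases "f w = 0")
    case False
    then have "(\<lambda>w. q w / f w) analytic_on {w}"
      using ana[OF w] by (intro analytic_on_divide) auto
    then show ?thesis using False by (simp add: A_def)
  qed (use zero[OF w] in simp)
qed

section \<open>Distance to the zeros and size of the logarithmic derivative\<close>

context carleson_points
begin

text \<open>If no zero lies within \<open>2 * t\<close> of \<open>w\<close>, the radius
  \<open>t\<close> works. Otherwise separation puts all other zeros at distance at least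
  \<open>4 * t\<close>, and the circle of radius \<open>3 * t\<close> passes between them and the
  near one.\<close>

lemma zero_avoiding_circle:
  assumes w: "norm w < 1"
  obtains r where "0 < r" "r \<le> 3 * \<delta> * (1 - norm w) / 16"
    "\<And>x n. norm (x - w) = r \<Longrightarrow> n \<in> N \<Longrightarrow> \<delta> * (1 - norm w) / 16 \<le> norm (x - z n)"
proof -
  define t where "t = \<delta> * (1 - norm w) / 16"
  have t: "0 < t" "t \<le> (1 - norm w) / 16" using \<delta>_pos \<delta>_le w by (auto simp: t_def)
  show thesis
  proof (cases "\<exists>n\<in>N. norm (z n - w) \<le> 2 * t")
    case False
    show thesis
    proof (rule that[of t])
      fix x n assume "norm (x - w) = t" "n \<in> N"
      then have "2 * t < norm (z n - w)" using False by auto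
      also have "norm (z n - w) \<le> norm (x - z n) + norm (x - w)"
        using norm_triangle_ineq4[of "x - w" "x - z n"] by (simp add: norm_minus_commute)
      finally show "\<delta> * (1 - norm w) / 16 \<le> norm (x - z n)"
        using \<open>norm (x - w) = t\<close> by (simp add: t_def)
    qed (use t \<delta>_pos w in \<open>auto simp: t_def\<close>)
  next
    case True
    then obtain m where m: "m \<in> N" "norm (z m - w) \<le> 2 * t" by blast
    have far: "4 * t \<le> norm (z n - w)" if n: "n \<in> N" "n \<noteq> m" for n
    proof (rule ccontr)
      assume "\<not> 4 * t \<le> norm (z n - w)"
      then have nw: "norm (z n - w) < 4 * t" by simp
      \<comment> \<open>As \<open>2 * t \<le> (1 - norm w) / 8\<close>, the near zero keeps 14/16 of
        the distance to the circle, so separation puts every other zero at least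
        \<open>14 * t\<close> away from it, more than the \<open>4 * t + 2 * t\<close> just
        assumed.\<close>
      have "1 - norm w \<le> 1 - norm (z m) + norm (z m - w)"
        using norm_triangle_ineq3[of "z m" w] by linarith
      then have dm: "14 * ((1 - norm w) / 16) \<le> 1 - norm (z m)"
        using m(2) t by (simp add: field_simps)
      have "14 * t = \<delta> * (14 * ((1 - norm w) / 16))" by (simp add: t_def)
      also have "\<dots> \<le> \<delta> * norm (1 - cnj (z n) * z m)"
        using norm_cnj_kernel_ge(3)[of "z n" "z m"] norm_z[OF n(1)] norm_z[OF m(1)] dm \<delta>_pos
        by (intro mult_left_mono) auto
      also have "\<dots> \<le> norm (z n - z m)" by (rule separated[OF n(1) m(1) n(2)])
      also have "\<dots> \<le> norm (z n - w) + norm (z m - w)"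
        using norm_triangle_ineq4[of "z n - w" "z m - w"] by simp
      finally show False using nw m(2) t by linarith
    qed
    show thesis
    proof (rule that[of "3 * t"])
      fix x n assume x: "norm (x - w) = 3 * t" and n: "n \<in> N"
      show "\<delta> * (1 - norm w) / 16 \<le> norm (x - z n)"
      proof (cases "n = m")
        case True
        have "norm (x - w) \<le> norm (x - z n) + norm (z n - w)"
          using norm_triangle_ineq[of "x - z n" "z n - w"] by simp
        then show ?thesis using x m(2) True by (simp add: t_def)
      next
        case False
        have "norm (z n - w) \<le> norm (x - z n) + norm (x - w)"
          using norm_triangle_ineq4[of "x - w" "x - z n"] by (simp add: norm_minus_commute)
        then show ?thesis using x far[OF n False] by (simp add: t_def)
      qed
    qed (use t in \<open>auto simp: t_def\<close>)
  qed
qed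

text \<open>At pseudohyperbolic distance at least \<open>\<epsilon>\<close> from the zero, the pole
  is worth one more kernel factor. This produces the cube in \<open>\<kappa>\<close>.\<close>

lemma norm_disc_logderiv_le:
  assumes n: "n \<in> N" and w: "norm w < 1" and \<epsilon>: "0 < \<epsilon>" "\<epsilon> * norm (1 - cnj (z n) * w) \<le> norm (w - z n)"
  shows "norm (disc_logderiv (z n) w) \<le> 4 / \<epsilon> * \<kappa> n w"
proof -
  have zn: "norm (z n) < 1" by (rule norm_z[OF n])
  define d X where "d = 1 - norm (z n)" and "X = norm (1 - cnj (z n) * w)"
  have X: "0 < X" using norm_cnj_kernel_ge(4)[of "z n" w] zn w by (simp add: X_def)
  have "1 - (norm (z n))\<^sup>2 \<le> 2 * d"
    using zero_le_power2[of "1 - norm (z n)"] by (simp add: d_def power2_diff)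
  then have "(1 - (norm (z n))\<^sup>2)\<^sup>2 \<le> (2 * d)\<^sup>2"
    using zn by (intro power_mono) (auto simp: power_le_one)
  then have "(1 - (norm (z n))\<^sup>2)\<^sup>2 / (norm (w - z n) * X\<^sup>2) \<le> (2 * d)\<^sup>2 / (\<epsilon> * X * X\<^sup>2)"
    using X \<epsilon> by (intro frac_le) (auto simp: X_def intro!: mult_pos_pos mult_right_mono)
  also have "\<dots> = 4 / \<epsilon> * \<kappa> n w"
    using n by (simp add: \<kappa>_def d_def[symmetric] X_def[symmetric] power2_eq_square power3_eq_cube)
  finally show ?thesis
    unfolding disc_logderiv_def norm_divide norm_mult norm_power norm_of_real X_def
    by (simp add: power2_eq_square)
qed

lemma norm_suminf_disc_logderiv_le:
  assumes I: "I \<subseteq> N" and w: "norm w < 1" and \<epsilon>: "0 < \<epsilon>"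
    and far: "\<And>n. n \<in> I \<Longrightarrow> \<epsilon> * norm (1 - cnj (z n) * w) \<le> norm (w - z n)"
  shows "norm (\<Sum>n. if n \<in> I then disc_logderiv (z n) w else 0) \<le> 4 / \<epsilon> * K w"
proof -
  have le: "norm (if n \<in> I then disc_logderiv (z n) w else 0) \<le> 4 / \<epsilon> * \<kappa> n w" for n
    using norm_disc_logderiv_le[OF _ w \<epsilon> far] I \<epsilon> by (auto simp: \<kappa>_nonneg)
  have "norm (\<Sum>n. if n \<in> I then disc_logderiv (z n) w else 0) \<le> (\<Sum>n. 4 / \<epsilon> * \<kappa> n w)"
    by (rule norm_suminf_le[OF le]) (intro summable_mult summable_\<kappa> w)
  also have "\<dots> = 4 / \<epsilon> * K w" unfolding K_def by (rule suminf_mult) (rule summable_\<kappa>[OF w])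
  finally show ?thesis .
qed

text \<open>Converts a distance measured against \<open>1 - norm w\<close> into one measured against
  the kernel, which is at most \<open>2 * (1 - norm w) + norm (w - z n)\<close>; hence the
  3.\<close>

lemma kernel_le_dist:
  assumes n: "n \<in> N" and w: "norm w < 1" and \<epsilon>: "0 < \<epsilon>" "\<epsilon> \<le> 1" "\<epsilon> * (1 - norm w) \<le> norm (w - z n)"
  shows "\<epsilon> / 3 * norm (1 - cnj (z n) * w) \<le> norm (w - z n)"
proof -
  have "1 - cnj (z n) * w = complex_of_real (1 - (norm w)\<^sup>2) + w * cnj (w - z n)"
    unfolding cnj_mult_self_complement[symmetric] by (simp add: algebra_simps)
  then have "norm (1 - cnj (z n) * w) \<le> \<bar>1 - (norm w)\<^sup>2\<bar> + norm w * norm (w - z n)"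
    by (metis norm_triangle_ineq norm_mult norm_of_real complex_mod_cnj)
  also have "norm w * norm (w - z n) \<le> norm (w - z n)" using w by (intro mult_left_le_one_le) auto
  also have "\<bar>1 - (norm w)\<^sup>2\<bar> \<le> 2 * (1 - norm w)"
    using zero_le_power2[of "1 - norm w"] w by (simp add: power2_diff power_le_one)
  finally have "norm (1 - cnj (z n) * w) \<le> 2 * (1 - norm w) + norm (w - z n)" by simp
  then have "\<epsilon> * norm (1 - cnj (z n) * w) \<le> \<epsilon> * (2 * (1 - norm w) + norm (w - z n))"
    using \<epsilon>(1) by (intro mult_left_mono) auto
  also have "\<dots> = 2 * (\<epsilon> * (1 - norm w)) + \<epsilon> * norm (w - z n)" by (simp add: algebra_simps)
  also have "\<dots> \<le> 2 * norm (w - z n) + 1 * norm (w - z n)"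
    using \<epsilon> by (intro add_mono mult_right_mono) auto
  finally show ?thesis by simp
qed

text \<open>The first term is the logarithmic derivative of \<open>disc_cofactor (z n)\<close> at
  \<open>z n\<close>, where its two summands coincide; the series is that of the product over the
  other points. Separation is exactly the distance condition with
  \<open>\<epsilon> = \<delta>\<close>.\<close>

lemma interpolation_data_le:
  assumes n: "n \<in> N"
  shows "norm (2 * cnj (z n) / complex_of_real (1 - (norm (z n))\<^sup>2) +
     (\<Sum>k. if k \<in> N - {n} then disc_logderiv (z k) (z n) else 0)) \<le> (2 + 4 / \<delta> * M) / (1 - norm (z n))"
proof -
  have zn: "norm (z n) < 1" by (rule norm_z[OF n])
  have "norm (\<Sum>k. if k \<in> N - {n} then disc_logderiv (z k) (z n) else 0) \<le> 4 / \<delta> * K (z n)"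
    using n separated by (intro norm_suminf_disc_logderiv_le zn \<delta>_pos) (auto simp: norm_minus_commute)
  also have "\<dots> \<le> 4 / \<delta> * (M / (1 - norm (z n)))"
    using K_le[OF zn] \<delta>_pos by (intro mult_left_mono) auto
  finally have 1: "norm (\<Sum>k. if k \<in> N - {n} then disc_logderiv (z k) (z n) else 0) \<le> 4 / \<delta> * M / (1 - norm (z n))"
    by simp
  have "1 - norm (z n) \<le> (1 - norm (z n)) * (1 + norm (z n))"
    using zn by (simp add: mult_le_cancel_left1)
  also have "\<dots> = 1 - (norm (z n))\<^sup>2" by (simp add: power2_eq_square algebra_simps)
  finally have "1 - norm (z n) \<le> \<bar>1 - (norm (z n))\<^sup>2\<bar>" by linarith
  then have "norm (2 * cnj (z n) / complex_of_real (1 - (norm (z n))\<^sup>2)) \<le> 2 / (1 - norm (z n))"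
    unfolding norm_divide norm_of_real norm_mult using zn by (intro frac_le) auto
  from norm_triangle_le[OF add_mono[OF this 1]] show ?thesis
    by (simp only: add_divide_distrib)
qed

text \<open>With \<open>a = z n\<close> and \<open>f w = (w - a) * H w\<close>, one has
  \<open>f'(a) = H a\<close> and \<open>f''(a) = 2 * H'(a)\<close>. The value \<open>c n\<close> is
  chosen to make the logarithmic derivative of \<open>H\<close> vanish at \<open>a\<close>; the
  factor \<open>exp g\<close> contributes \<open>h a\<close> to it.\<close>

lemma solution_exists:
  obtains f h C where "f holomorphic_on unit_disc"
    "\<And>w. norm w < 1 \<Longrightarrow> f w = 0 \<longleftrightarrow> w \<in> z ` N"
    "\<And>n. n \<in> N \<Longrightarrow> deriv f (z n) \<noteq> 0 \<and> deriv (deriv f) (z n) = 0 \<and> zorder f (z n) = 1"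
    "0 < C" "\<And>w. norm w < 1 \<Longrightarrow> norm (h w) \<le> C * K w"
    "\<And>w. norm w < 1 \<Longrightarrow> w \<notin> z ` N \<Longrightarrow>
       deriv f w / f w = (\<Sum>n. if n \<in> N then disc_logderiv (z n) w else 0) + h w"
proof -
  define c where "c n = - (2 * cnj (z n) / complex_of_real (1 - (norm (z n))\<^sup>2) +
     (\<Sum>k. if k \<in> N - {n} then disc_logderiv (z k) (z n) else 0))" for n
  define C0 where "C0 = 2 + 4 / \<delta> * M"
  have C0: "0 < C0" using \<delta>_pos M_pos by (simp add: C0_def add_pos_pos)
  obtain h where h: "h holomorphic_on unit_disc" "\<And>n. n \<in> N \<Longrightarrow> h (z n) = c n"
    "\<And>w. norm w < 1 \<Longrightarrow> norm (h w) \<le> 8 * C0 / \<eta> * K w"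
  proof (rule interpolation[of c C0])
    show "norm (c n) \<le> C0 / (1 - norm (z n))" if "n \<in> N" for n
      unfolding c_def C0_def norm_minus_cancel by (rule interpolation_data_le[OF that])
  qed (use C0 in auto)
  obtain g where g: "\<And>w. w \<in> unit_disc \<Longrightarrow> (g has_field_derivative h w) (at w)"
    using holomorphic_convex_primitive'[OF convex_ball open_ball h(1)] by (auto simp: at_within_open[of _ unit_disc])
  define G where "G = canonical_product N"
  define f where "f w = G w * exp (g w)" for w
  have G_hol: "canonical_product I holomorphic_on unit_disc" if "I \<subseteq> N" for I
    by (rule canonical_product_holomorphic[OF that])
  have g_hol: "g holomorphic_on unit_disc"
    unfolding holomorphic_on_open[OF open_ball] using g by blast
  have f_hol: "f holomorphic_on unit_disc"
    unfolding f_def[abs_def] G_def by (intro holomorphic_intros G_hol g_hol) auto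
  have f_zero: "f w = 0 \<longleftrightarrow> w \<in> z ` N" if "norm w < 1" for w
    unfolding f_def G_def using canonical_product_eq_0_iff[of N w] that by simp
  have logd: "deriv f w / f w = (\<Sum>n. if n \<in> N then disc_logderiv (z n) w else 0) + h w"
    if w: "norm w < 1" "w \<notin> z ` N" for w
  proof -
    have nz: "G w \<noteq> 0" using canonical_product_eq_0_iff[of N w] w by (simp add: G_def)
    have "(G has_field_derivative deriv G w) (at w)"
      unfolding G_def using w by (intro holomorphic_derivI[OF G_hol[OF order_refl] open_ball]) simp
    then have "(f has_field_derivative (deriv G w * exp (g w) + exp (g w) * h w * G w)) (at w)"
      unfolding f_def[abs_def] using g[of w] w by (auto intro!: derivative_eq_intros)
    then have "deriv f w / f w = deriv G w / G w + h w"
      using nz by (simp add: DERIV_imp_deriv f_def field_simps)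
    also have "deriv G w / G w = (\<Sum>n. if n \<in> N then disc_logderiv (z n) w else 0)"
      unfolding G_def by (rule sums_unique) (rule canonical_product_logderiv[OF order_refl w])
    finally show ?thesis .
  qed
  have at_zero: "deriv f (z n) \<noteq> 0 \<and> deriv (deriv f) (z n) = 0 \<and> zorder f (z n) = 1" if n: "n \<in> N" for n
  proof -
    define a where "a = z n"
    have a: "norm a < 1" using norm_z[OF n] by (simp add: a_def)
    define G' where "G' = canonical_product (N - {n})"
    define H where "H w = disc_cofactor a w * G' w * exp (g w)" for w
    have H_hol: "H holomorphic_on unit_disc"
      unfolding H_def[abs_def] G'_def by (intro holomorphic_intros G_hol g_hol a) auto
    have a_notin: "a \<notin> z ` (N - {n})"
    proof
      assume "a \<in> z ` (N - {n})"
      then obtain k where k: "k \<in> N" "k \<noteq> n" "z k = z n" 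
        unfolding a_def by (metis DiffD1 DiffD2 imageE singletonI)
      have "0 < \<delta> * norm (1 - cnj (z k) * z n)"
        using norm_z[OF k(1)] norm_z[OF n]
        by (intro mult_pos_pos \<delta>_pos norm_cnj_kernel_ge(4)) auto
      then show False using separated[OF k(1) n k(2)] k(3) by simp
    qed
    have G'a: "G' a \<noteq> 0" unfolding G'_def using canonical_product_eq_0_iff[of "N - {n}" a] a a_notin by auto
    have Ha: "H a \<noteq> 0" unfolding H_def using G'a disc_cofactor_nonzero[of a a] a by simp
    have fH: "f w = (w - a) * H w" if w: "norm w < 1" for w
      using canonical_product_remove[OF order_refl n w] disc_factor_eq[of a w] a w
      by (simp add: f_def G_def H_def G'_def a_def)
    have "deriv H a = 0"
    proof -
      define s where "s = complex_of_real (1 - (norm a)\<^sup>2)"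
      have s: "1 - cnj a * a = s" by (simp add: s_def cnj_mult_self_complement del: of_real_diff)
      have s0: "s \<noteq> 0" using cnj_kernel_nonzero[of a a] a s by auto
      have dG': "(G' has_field_derivative deriv G' a) (at a)"
        unfolding G'_def using a by (intro holomorphic_derivI[OF G_hol open_ball]) auto
      have "(H has_field_derivative (disc_cofactor a a * (cnj a / s + s * cnj a / s\<^sup>2) * G' a * exp (g a) +
         disc_cofactor a a * deriv G' a * exp (g a) + disc_cofactor a a * G' a * (exp (g a) * h a))) (at a)"
        unfolding H_def[abs_def]
        using disc_cofactor_has_field_derivative[OF a a] dG' g[of a] a
        by (auto intro!: derivative_eq_intros simp: s s_def[symmetric] simp del: of_real_diff) (simp add: algebra_simps)
      also have "disc_cofactor a a * (cnj a / s + s * cnj a / s\<^sup>2) * G' a * exp (g a) +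
         disc_cofactor a a * deriv G' a * exp (g a) + disc_cofactor a a * G' a * (exp (g a) * h a)
         = H a * (2 * cnj a / s + deriv G' a / G' a + h a)"
        unfolding H_def using G'a s0 by (simp add: field_simps power2_eq_square)
      also have "deriv G' a / G' a = (\<Sum>k. if k \<in> N - {n} then disc_logderiv (z k) a else 0)"
        unfolding G'_def by (rule sums_unique) (rule canonical_product_logderiv[OF Diff_subset a a_notin])
      also have "h a = c n" using h(2)[OF n] by (simp add: a_def)
      also have "2 * cnj a / s + (\<Sum>k. if k \<in> N - {n} then disc_logderiv (z k) a else 0) + c n = 0"
        unfolding c_def s_def a_def by simp
      finally show ?thesis by (simp add: DERIV_imp_deriv)
    qed
    have df: "deriv f w = H w + (w - a) * deriv H w" if w: "w \<in> unit_disc" for w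
    proof (rule DERIV_imp_deriv)
      have "((\<lambda>w. (w - a) * H w) has_field_derivative (H w + (w - a) * deriv H w)) (at w)"
        using holomorphic_derivI[OF H_hol open_ball w] by (auto intro!: derivative_eq_intros)
      then show "(f has_field_derivative (H w + (w - a) * deriv H w)) (at w)"
        by (rule has_field_derivative_transform_within_open[of _ _ _ unit_disc]) (use w fH in auto)
    qed
    have aD: "a \<in> unit_disc" using a by simp
    have "(deriv f has_field_derivative 0) (at a)"
    proof -
      have "((\<lambda>w. H w + (w - a) * deriv H w) has_field_derivative (2 * deriv H a)) (at a)"
        using holomorphic_derivI[OF H_hol open_ball aD]
          holomorphic_derivI[OF holomorphic_deriv[OF H_hol open_ball] open_ball aD]
        by (auto intro!: derivative_eq_intros)
      then have "((\<lambda>w. H w + (w - a) * deriv H w) has_field_derivative 0) (at a)"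
        using \<open>deriv H a = 0\<close> by simp
      then show ?thesis
        by (rule has_field_derivative_transform_within_open[of _ _ _ unit_disc]) (use aD df in auto)
    qed
    moreover have "zorder f a = 1"
      by (rule simple_zeroI[OF open_ball aD H_hol Ha]) (use fH in \<open>simp add: mult.commute\<close>)
    moreover have "deriv f a \<noteq> 0" using df[OF aD] Ha by simp
    ultimately show ?thesis by (simp add: DERIV_imp_deriv a_def)
  qed
  have "0 < 8 * C0 / \<eta>" using C0 \<eta>_pos by simp
  from that[OF f_hol f_zero at_zero this h(3) logd] show thesis .
qed

end

section \<open>The coefficient\<close>

context carleson_points
begin

lemma inj_on_z: "inj_on z N"
proof (rule inj_onI, rule ccontr)
  fix n k assume *: "n \<in> N" "k \<in> N" "z n = z k" "n \<noteq> k"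
  have "0 < \<delta> * norm (1 - cnj (z n) * z k)"
    using norm_z[OF *(1)] norm_z[OF *(2)] by (intro mult_pos_pos \<delta>_pos norm_cnj_kernel_ge(4)) auto
  then show False using separated[OF *(1,2,4)] *(3) by simp
qed

text \<open>Off the zeros, \<open>A = - (l' + l ^ 2)\<close> with \<open>l = f' / f\<close>. In the
  square one \<open>K\<close> is traded for \<open>M / (1 - norm w)\<close>, which matches the
  factor that Cauchy's estimate costs for \<open>l'\<close>. Only a circle around \<open>w\<close>
  has to avoid the poles of \<open>l\<close>, and near it \<open>K\<close> is at most
  \<open>8 * K w\<close>.\<close>

lemma coefficient_bound:
  assumes f: "f holomorphic_on unit_disc" and f0: "\<And>w. norm w < 1 \<Longrightarrow> f w = 0 \<longleftrightarrow> w \<in> z ` N"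
    and A: "A holomorphic_on unit_disc"
    and ode: "\<And>w. norm w < 1 \<Longrightarrow> deriv (deriv f) w + A w * f w = 0"
    and C: "0 < C" and h: "\<And>w. norm w < 1 \<Longrightarrow> norm (h w) \<le> C * K w"
    and L: "\<And>w. norm w < 1 \<Longrightarrow> w \<notin> z ` N \<Longrightarrow>
       deriv f w / f w = (\<Sum>n. if n \<in> N then disc_logderiv (z n) w else 0) + h w"
  obtains B where "0 < B" "\<And>w. norm w < 1 \<Longrightarrow> norm (A w) \<le> B * K w / (1 - norm w)"
proof -
  define \<epsilon> where "\<epsilon> = \<delta> / 16"
  have \<epsilon>: "0 < \<epsilon>" "\<epsilon> \<le> 1 / 16" using \<delta>_pos \<delta>_le by (auto simp: \<epsilon>_def)
  \<comment> \<open>\<open>48 / \<epsilon> = 4 / (\<epsilon> / 12)\<close>: the distance to the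
    zeros shrinks to \<open>\<epsilon> / 4\<close> relative to \<open>1 - norm x\<close>, and
    comparison with the kernel costs 3.\<close>
  define C1 where "C1 = 48 / \<epsilon> + C"
  have C1: "0 < C1" using C \<epsilon> by (simp add: C1_def add_pos_pos)
  \<comment> \<open>The first term is Cauchy's estimate with bound \<open>8 * C1 * K w\<close> and
    radius \<open>\<epsilon> * d / 2\<close>, the second the square of that bound with one
    \<open>K w\<close> replaced by \<open>M / d\<close>, where
    \<open>d = 1 - norm w\<close>.\<close>
  define B where "B = 16 * C1 / \<epsilon> + 64 * C1\<^sup>2 * M"
  have B: "0 < B" using C1 \<epsilon> M_pos by (simp add: B_def add_pos_pos)
  define l where "l w = deriv f w / f w" for w
  have l_bound: "norm (l x) \<le> C1 * K x"
    if x: "norm x < 1" and far: "\<And>n. n \<in> N \<Longrightarrow> \<epsilon> / 4 * (1 - norm x) \<le> norm (x - z n)" for x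
  proof -
    have "x \<notin> z ` N"
    proof
      assume "x \<in> z ` N"
      then have "\<epsilon> / 4 * (1 - norm x) \<le> 0" using far by force
      moreover have "0 < \<epsilon> / 4 * (1 - norm x)" using \<epsilon> x by (intro mult_pos_pos) auto
      ultimately show False by simp
    qed
    then have "l x = (\<Sum>n. if n \<in> N then disc_logderiv (z n) x else 0) + h x"
      unfolding l_def by (rule L[OF x])
    moreover have "norm (\<Sum>n. if n \<in> N then disc_logderiv (z n) x else 0) \<le> 4 / (\<epsilon> / 4 / 3) * K x"
      using \<epsilon> far by (intro norm_suminf_disc_logderiv_le x kernel_le_dist) auto
    ultimately have "norm (l x) \<le> 4 / (\<epsilon> / 4 / 3) * K x + C * K x"
      using norm_triangle_mono h[OF x] by metis
    then show ?thesis by (simp add: C1_def algebra_simps)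
  qed
  have circle: "norm (A x) \<le> B * K w / (1 - norm w)"
    if w: "norm w < 1" and xw: "norm (x - w) \<le> 3 * (1 - norm w) / 16"
      and far: "\<And>n. n \<in> N \<Longrightarrow> \<epsilon> * (1 - norm w) \<le> norm (x - z n)" for x w
  proof -
    define d where "d = 1 - norm w"
    have d: "0 < d" using w by (simp add: d_def)
    \<comment> \<open>Half of the distance \<open>\<epsilon> * d\<close> to the zeros is given up;
      since \<open>1 - norm y \<le> 2 * d\<close>, the other half is \<open>\<epsilon> / 4\<close>
      relative to \<open>1 - norm y\<close>.\<close>
    define \<rho> where "\<rho> = \<epsilon> * d / 2"
    have \<rho>: "0 < \<rho>" "\<rho> \<le> d / 32" using \<epsilon> d mult_right_mono[OF \<epsilon>(2), of d] by (auto simp: \<rho>_def)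
    have near: "norm y < 1 \<and> y \<notin> z ` N \<and> norm (l y) \<le> 8 * C1 * K w" if y: "y \<in> cball x \<rho>" for y
    proof -
      have yx: "norm (x - y) \<le> \<rho>" using y by (simp add: dist_norm)
      have "norm (y - w) \<le> norm (x - w) + norm (x - y)"
        using norm_triangle_ineq4[of "x - w" "x - y"] by simp
      then have yw: "norm (y - w) \<le> d / 4" using xw yx \<rho> by (simp add: d_def field_simps)
      have yn: "norm y \<le> norm w + d / 4" "norm w - d / 4 \<le> norm y"
        using norm_triangle_ineq3[of y w] yw by linarith+
      then have ny: "norm y < 1" using d by (simp add: d_def field_simps)
      have far': "\<epsilon> / 2 * d \<le> norm (y - z n)" if n: "n \<in> N" for n
      proof -
        have "\<epsilon> * d \<le> norm (x - z n)" using far[OF n] by (simp add: d_def)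
        also have "\<dots> \<le> norm (x - y) + norm (y - z n)"
          using norm_triangle_ineq[of "x - y" "y - z n"] by simp
        finally show ?thesis using yx by (simp add: \<rho>_def)
      qed
      have far4: "\<epsilon> / 4 * (1 - norm y) \<le> norm (y - z n)" if n: "n \<in> N" for n
      proof -
        have "1 - norm y \<le> 2 * d" using yn d by (simp add: d_def field_simps)
        then have "\<epsilon> / 4 * (1 - norm y) \<le> \<epsilon> / 4 * (2 * d)" using \<epsilon> by (intro mult_left_mono) auto
        then show ?thesis using far'[OF n] by simp
      qed
      have "y \<notin> z ` N"
      proof
        assume "y \<in> z ` N"
        then have "\<epsilon> / 2 * d \<le> 0" using far' by force
        moreover have "0 < \<epsilon> / 2 * d" using \<epsilon> d by (intro mult_pos_pos) auto
        ultimately show False by simp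
      qed
      moreover have "norm (l y) \<le> 8 * C1 * K w"
      proof -
        have "norm (l y) \<le> C1 * K y" by (rule l_bound[OF ny far4])
        also have "\<dots> \<le> C1 * (8 * K w)"
          using K_comparable[OF w, of y] yw d C1 by (intro mult_left_mono) (auto simp: d_def)
        finally show ?thesis by simp
      qed
      ultimately show ?thesis using ny by blast
    qed
    have x: "x \<in> unit_disc" "f x \<noteq> 0" using near[of x] f0[of x] \<rho> by auto
    have l_hol: "l holomorphic_on cball x \<rho>"
      unfolding l_def[abs_def]
    proof (intro holomorphic_on_divide)
      show "deriv f holomorphic_on cball x \<rho>"
        by (rule holomorphic_on_subset[OF holomorphic_deriv[OF f open_ball]]) (use near in auto)
      show "f holomorphic_on cball x \<rho>"
        by (rule holomorphic_on_subset[OF f]) (use near in auto)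
    qed (use near f0 in auto)
    have "norm ((deriv ^^ 1) l x) \<le> fact 1 * (8 * C1 * K w) / \<rho> ^ 1"
    proof (rule Cauchy_inequality)
      show "l holomorphic_on ball x \<rho>" by (rule holomorphic_on_subset[OF l_hol]) auto
      show "continuous_on (cball x \<rho>) l" by (rule holomorphic_on_imp_continuous_on[OF l_hol])
      show "norm (l y) \<le> 8 * C1 * K w" if "norm (x - y) = \<rho>" for y
        using near[of y] that by (simp add: dist_norm)
    qed (rule \<rho>)
    then have dl: "norm (deriv l x) \<le> 16 * C1 / \<epsilon> * K w / d" using \<epsilon> d by (simp add: \<rho>_def)
    have "deriv (deriv f) x / f x = deriv l x + (l x)\<^sup>2"
    proof -
      have "(deriv f has_field_derivative deriv (deriv f) x) (at x)"
        by (rule holomorphic_derivI[OF holomorphic_deriv[OF f open_ball] open_ball x(1)])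
      moreover have "(f has_field_derivative deriv f x) (at x)"
        by (rule holomorphic_derivI[OF f open_ball x(1)])
      ultimately have "(l has_field_derivative
          ((deriv (deriv f) x * f x - deriv f x * deriv f x) / (f x * f x))) (at x)"
        unfolding l_def[abs_def] using x(2) by (intro DERIV_divide)
      then show ?thesis using x(2) by (simp add: DERIV_imp_deriv l_def power2_eq_square field_simps)
    qed
    moreover have "A x = - (deriv (deriv f) x / f x)"
      using ode[of x] x by (simp add: field_simps add_eq_0_iff2)
    ultimately have "norm (A x) \<le> norm (deriv l x) + (norm (l x))\<^sup>2"
      by (simp only: norm_minus_cancel) (metis norm_triangle_ineq norm_power)
    also have "\<dots> \<le> 16 * C1 / \<epsilon> * K w / d + (8 * C1 * K w)\<^sup>2"
      using near[of x] \<rho> by (intro add_mono dl power_mono) auto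
    also have "(8 * C1 * K w)\<^sup>2 = 64 * C1\<^sup>2 * K w * K w" by (simp add: power2_eq_square)
    also have "\<dots> \<le> 64 * C1\<^sup>2 * K w * (M / d)"
      using K_le[OF w] K_nonneg[OF w] by (intro mult_left_mono) (auto simp: d_def)
    also have "16 * C1 / \<epsilon> * K w / d + 64 * C1\<^sup>2 * K w * (M / d) = B * K w / d"
      by (simp add: B_def algebra_simps add_divide_distrib)
    finally show ?thesis by (simp add: d_def)
  qed
  show thesis
  proof (rule that[OF B])
    fix w :: complex assume w: "norm w < 1"
    obtain r where r: "0 < r" "r \<le> 3 * \<delta> * (1 - norm w) / 16"
      "\<And>x n. norm (x - w) = r \<Longrightarrow> n \<in> N \<Longrightarrow> \<delta> * (1 - norm w) / 16 \<le> norm (x - z n)"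
      using zero_avoiding_circle[OF w] by metis
    have "\<delta> * (1 - norm w) \<le> 1 * (1 - norm w)" using \<delta>_le w by (intro mult_right_mono) auto
    then have r': "r \<le> 3 * (1 - norm w) / 16" using r(2) by linarith
    have sub: "cball w r \<subseteq> unit_disc"
    proof
      fix x assume "x \<in> cball w r"
      then have "norm (x - w) \<le> r" by (simp add: dist_norm norm_minus_commute)
      then have "norm x \<le> norm w + r" using norm_triangle_ineq2[of x w] by linarith
      then show "x \<in> unit_disc" using r' w by (simp add: field_simps)
    qed
    show "norm (A w) \<le> B * K w / (1 - norm w)"
    proof (rule maximum_modulus_frontier[of A "cball w r"])
      show "A holomorphic_on interior (cball w r)"
        by (rule holomorphic_on_subset[OF A]) (use sub interior_subset in blast)
      show "continuous_on (closure (cball w r)) A"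
        using holomorphic_on_imp_continuous_on[OF holomorphic_on_subset[OF A sub]] by simp
      fix x assume "x \<in> frontier (cball w r)"
      then have x: "norm (x - w) = r"
        using r(1) by (simp add: frontier_cball dist_norm norm_minus_commute)
      show "norm (A x) \<le> B * K w / (1 - norm w)"
        by (rule circle[OF w]) (use x r r' in \<open>auto simp: \<epsilon>_def\<close>)
    qed (use r in auto)
  qed
qed

lemma equation_exists:
  obtains A f B where "A holomorphic_on unit_disc" "f holomorphic_on unit_disc"
    "0 < B" "\<And>w. norm w < 1 \<Longrightarrow> norm (A w) \<le> B * K w / (1 - norm w)"
    "\<And>w. norm w < 1 \<Longrightarrow> deriv (deriv f) w + A w * f w = 0"
    "\<exists>w\<in>unit_disc. f w \<noteq> 0" "zero_sequence f N z"
proof -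
  obtain f h C where f: "f holomorphic_on unit_disc"
    and f0: "\<And>w. norm w < 1 \<Longrightarrow> f w = 0 \<longleftrightarrow> w \<in> z ` N"
    and fz: "\<And>n. n \<in> N \<Longrightarrow> deriv f (z n) \<noteq> 0 \<and> deriv (deriv f) (z n) = 0 \<and> zorder f (z n) = 1"
    and C: "0 < C" and h: "\<And>w. norm w < 1 \<Longrightarrow> norm (h w) \<le> C * K w"
    and L: "\<And>w. norm w < 1 \<Longrightarrow> w \<notin> z ` N \<Longrightarrow>
       deriv f w / f w = (\<Sum>n. if n \<in> N then disc_logderiv (z n) w else 0) + h w"
    by (rule solution_exists) (rule that; assumption)
  \<comment> \<open>The zeros are countable and the disc is not, so \<open>f\<close> does not vanish
    identically.\<close>
  have "uncountable unit_disc" by (rule uncountable_ball) simp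
  then have "\<not> unit_disc \<subseteq> z ` N" by (meson countable_image countable_subset countableI_type)
  then have nz: "\<exists>w\<in>unit_disc. f w \<noteq> 0" using f0 by auto
  obtain A where A: "A holomorphic_on unit_disc" "\<And>w. w \<in> unit_disc \<Longrightarrow> - deriv (deriv f) w = A w * f w"
  proof (rule removable_quotient_at_simple_zeros[OF f _ open_ball connected_ball nz])
    show "(\<lambda>w. - deriv (deriv f) w) holomorphic_on unit_disc"
      by (intro holomorphic_intros holomorphic_deriv f) auto
    show "- deriv (deriv f) w = 0 \<and> deriv f w \<noteq> 0" if "w \<in> unit_disc" "f w = 0" for w
      using that f0[of w] fz by auto
  qed auto
  have ode: "deriv (deriv f) w + A w * f w = 0" if "norm w < 1" for w
    using A(2)[of w, symmetric] that by simp
  obtain B where B: "0 < B" "\<And>w. norm w < 1 \<Longrightarrow> norm (A w) \<le> B * K w / (1 - norm w)"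
    using coefficient_bound[OF f f0 A(1) ode C h L] by metis
  have "zero_sequence f N z"
    unfolding zero_sequence_def
  proof (intro conjI ballI)
    fix w assume w: "w \<in> unit_disc"
    have "finite {n \<in> N. z n = w} \<and> zorder f w = int (card {n \<in> N. z n = w})"
    proof (cases "w \<in> z ` N")
      case True
      then obtain n where n: "n \<in> N" "w = z n" by blast
      then have "{k \<in> N. z k = w} = {n}" using inj_on_z by (auto dest: inj_onD)
      then show ?thesis using fz[OF n(1)] n by simp
    next
      case False
      have "f analytic_on {w}" using f w by (auto intro: holomorphic_on_imp_analytic_at)
      moreover have "f w \<noteq> 0" using f0[of w] False w by simp
      ultimately have "zorder f w = 0" by (rule zorder_eq_0I)
      moreover have none: "{n \<in> N. z n = w} = {}" using False by auto
      ultimately show ?thesis unfolding none by simp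
    qed
    then show "finite {n \<in> N. z n = w}" "zorder f w = int (card {n \<in> N. z n = w})" by auto
  qed (use norm_z in auto)
  from that[OF A(1) f B ode nz this] show thesis .
qed

end

section \<open>The Carleson condition for the coefficient\<close>

text \<open>The kernel is a quasi-distance: passing through \<open>c\<close> leaves a defect of
  modulus at most \<open>2 * (1 - norm c)\<close>, which is absorbed into the kernel of
  \<open>a\<close> and \<open>c\<close> and gives the 3.\<close>

lemma quasi_triangle_kernel:
  assumes "norm a < 1" "norm b < 1" "norm c < 1"
  shows "norm (1 - cnj a * b) \<le> 3 * norm (1 - cnj a * c) + norm (1 - cnj c * b)"
proof -
  have "1 - cnj a * b = (1 - cnj a * c) + cnj a * c * (1 - cnj c * b) - cnj a * b * (1 - cnj c * c)"
    by (simp add: algebra_simps)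
  also have "norm \<dots> \<le> norm (1 - cnj a * c) + norm (cnj a * c * (1 - cnj c * b)) + norm (cnj a * b * (1 - cnj c * c))"
    by (rule order_trans[OF norm_triangle_ineq4 add_right_mono[OF norm_triangle_ineq]])
  also have "norm (cnj a * c * (1 - cnj c * b)) \<le> norm (1 - cnj c * b)"
    unfolding norm_mult using assms by (intro mult_left_le_one_le mult_le_one mult_nonneg_nonneg) auto
  also have "norm (cnj a * b * (1 - cnj c * c)) \<le> norm (1 - cnj c * c)"
    unfolding norm_mult using assms by (intro mult_left_le_one_le mult_le_one mult_nonneg_nonneg) auto
  also have "norm (1 - cnj c * c) \<le> 2 * (1 - norm c)"
    unfolding cnj_mult_self_complement norm_of_real
    using assms zero_le_power2[of "1 - norm c"] by (simp add: power2_diff power_le_one)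
  also have "1 - norm c \<le> norm (1 - cnj a * c)" using norm_cnj_kernel_ge(3)[of a c] assms by simp
  finally show ?thesis by simp
qed

section \<open>Carleson squares inside kernel balls\<close>

lemma norm_cis_minus_1_le: "norm (cis t - 1) \<le> \<bar>t\<bar>"
  using dist_exp_i_1[of t] abs_sin_x_le_abs_x[of "t / 2"] by (simp add: cis_conv_exp)

lemma arc_angles_diameter:
  assumes J: "J \<in> arc_angles" and s: "s \<in> J" and t: "t \<in> J"
  shows "\<bar>s - t\<bar> \<le> 2 * pi * arc_length J"
proof -
  have pos: "0 < measure lborel J" and int: "is_interval J" using J by (auto simp: arc_angles_def)
  have "{min s t..max s t} \<subseteq> J"
    using mem_is_interval_1_I[OF int, of "min s t" "max s t"] s t by (auto simp: min_def max_def)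
  moreover have "J \<in> fmeasurable lborel"
  proof (rule fmeasurableI)
    show "J \<in> sets lborel" using real_interval_borel_measurable[OF int] by simp
    \<comment> \<open>For infinite length \<open>measure\<close> would return 0, against
      \<open>pos\<close>.\<close>
    show "emeasure lborel J < \<infinity>"
      using pos by (cases "emeasure lborel J") (auto simp: measure_def)
  qed
  ultimately have "measure lborel {min s t..max s t} \<le> measure lborel J"
    by (intro measure_mono_fmeasurable) auto
  then show ?thesis by (simp add: arc_length_def min_def max_def abs_if split: if_splits)
qed

text \<open>\<open>a\<close> is the point with angle \<open>t0\<close> in \<open>J\<close> on the
  inner edge of the square. The radii contribute at most \<open>2 * l\<close> and the angles at most
  \<open>2 * pi * l\<close>, and \<open>2 + 2 * pi < 9\<close>.\<close>

lemma carleson_square_subset: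
  assumes J: "J \<in> arc_angles"
  obtains a where "norm a < 1" "1 - norm a = arc_length J"
    "carleson_square J \<subseteq> {w \<in> unit_disc. norm (1 - cnj a * w) \<le> 9 * arc_length J}"
proof -
  define l where "l = arc_length J"
  have l: "0 < l" "l \<le> 1" using J by (auto simp: arc_angles_def l_def arc_length_def)
  have "J \<noteq> {}" using J by (auto simp: arc_angles_def)
  then obtain t0 where t0: "t0 \<in> J" by blast
  define a where "a = rcis (1 - l) t0"
  have na: "norm a = 1 - l" using l by (simp add: a_def)
  show thesis
  proof (rule that[of a])
    show "carleson_square J \<subseteq> {w \<in> unit_disc. norm (1 - cnj a * w) \<le> 9 * arc_length J}"
    proof
      fix w assume "w \<in> carleson_square J"
      then obtain r s t where w: "w = rcis r s" "1 - l \<le> r" "r < 1" "t \<in> J" "cis s = cis t"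
        unfolding carleson_square_def l_def by auto
      then have wt: "w = rcis r t" by (simp add: rcis_def)
      have r0: "0 \<le> r" using w(2) l by simp
      have "1 - cnj a * w = of_real (1 - (1 - l) * r) - of_real ((1 - l) * r) * (cis (t - t0) - 1)"
      proof -
        have "cis (t - t0) = cis t * cis (- t0)" by (simp add: cis_mult)
        then show ?thesis unfolding a_def wt rcis_def by (simp add: cis_cnj algebra_simps)
      qed
      also have "norm \<dots> \<le> norm (complex_of_real (1 - (1 - l) * r)) + norm (of_real ((1 - l) * r) * (cis (t - t0) - 1))"
        by (rule norm_triangle_ineq4)
      also have "norm (complex_of_real (1 - (1 - l) * r)) \<le> 2 * l"
      proof -
        have "(1 - l) * r \<le> 1 * 1" using l r0 w by (intro mult_mono) auto
        moreover have "(1 - l) * (1 - l) \<le> (1 - l) * r" using l w by (intro mult_left_mono) auto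
        moreover have "1 - 2 * l \<le> (1 - l) * (1 - l)" by (simp add: algebra_simps)
        ultimately show ?thesis unfolding norm_of_real by linarith
      qed
      also have "norm (of_real ((1 - l) * r) * (cis (t - t0) - 1)) \<le> norm (cis (t - t0) - 1)"
        unfolding norm_mult norm_of_real abs_mult using l r0 w
        by (intro mult_left_le_one_le mult_le_one) auto
      also have "\<dots> \<le> 2 * pi * l"
        using norm_cis_minus_1_le[of "t - t0"] arc_angles_diameter[OF J w(4) t0] by (simp add: l_def)
      also have "2 * l + 2 * pi * l \<le> 9 * l"
      proof -
        have "(2 + 2 * pi) * l \<le> 9 * l" using l pi_approx by (intro mult_right_mono) auto
        then show ?thesis by (simp add: algebra_simps)
      qed
      finally have "norm (1 - cnj a * w) \<le> 9 * l" by simp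
      then show "w \<in> {w \<in> unit_disc. norm (1 - cnj a * w) \<le> 9 * arc_length J}"
        using wt w r0 by (simp add: l_def)
    qed
  qed (use na l in \<open>auto simp: l_def\<close>)
qed

section \<open>Area integrals of the kernel sum over Carleson squares\<close>

context carleson_points
begin

definition area_const :: real where "area_const = 480 * (1 / p + 2)"

lemma area_const_pos: "0 < area_const" using p_pos by (simp add: area_const_def add_pos_pos)

text \<open>If \<open>D \<le> 54 * l\<close>, the integral over the whole disc is affordable: it is
  of order \<open>d ^ 2 * d powr (p - 2) = d powr p\<close>, while \<open>l / D\<close> is bounded
  below, and \<open>54 ^ 2 \<le> 5832\<close>. If \<open>D > 54 * l\<close>, then
  \<open>3 * X \<le> 27 * l < D / 2\<close> forces \<open>Y \<ge> D / 2\<close>, and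
  \<open>X \<le> 9 * l\<close> allows the kernel at \<open>z n\<close> to be replaced by the one at
  \<open>a\<close>. The same area estimate then applies with \<open>b = a\<close>, at the cost of
  \<open>(2 * 9) ^ 3 = 5832\<close>.\<close>

lemma nn_integral_\<kappa>_near_le:
  assumes a: "norm a < 1" and n: "n \<in> N"
  defines "l \<equiv> 1 - norm a"
  shows "(\<integral>\<^sup>+ w. ennreal ((1 - norm w) powr (p - 1) * \<kappa> n w) *
            indicator {w \<in> unit_disc. norm (1 - cnj a * w) \<le> 9 * l} w \<partial>lborel)
     \<le> ennreal (5832 * area_const * l powr (p + 1) *
          ((1 - norm (z n)) powr p / norm (1 - cnj a * z n) powr (p + 1)))"
proof -
  define d where "d = 1 - norm (z n)"
  have zn: "norm (z n) < 1" by (rule norm_z[OF n])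
  have d: "0 < d" and l: "0 < l" using zn a by (auto simp: d_def l_def)
  define D where "D = norm (1 - cnj a * z n)"
  have D: "0 < D" "d \<le> D"
    using norm_cnj_kernel_ge(3,4)[of a "z n"] zn a by (auto simp: D_def d_def)
  define Q where "Q = {w \<in> unit_disc. norm (1 - cnj a * w) \<le> 9 * l}"
  define I where "I b = (\<integral>\<^sup>+ w. ennreal ((1 - norm w) powr (p - 1) / norm (1 - cnj b * w) ^ 3) * indicator unit_disc w \<partial>lborel)" for b
  have I: "I b \<le> ennreal (area_const * (1 - norm b) powr (p - 2))" if "norm b < 1" for b
    unfolding I_def area_const_def by (rule nn_integral_kernel_le[OF p_pos p_le_1 that])
  have meas [measurable]: "(\<lambda>w. ennreal ((1 - norm w) powr (p - 1) / norm (1 - cnj b * w) ^ 3) * indicator unit_disc w) \<in> borel_measurable borel" for b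
  proof -
    have [measurable]: "unit_disc \<in> sets borel" by simp
    show ?thesis by measurable
  qed
  have dm: "d\<^sup>2 = d powr p * d powr (2 - p)"
    using d by (simp add: powr_add[symmetric])
  have from_pointwise: "(\<integral>\<^sup>+ w. ennreal ((1 - norm w) powr (p - 1) * \<kappa> n w) * indicator Q w \<partial>lborel)
      \<le> ennreal (c * (area_const * (1 - norm b) powr (p - 2)))"
    if b: "norm b < 1" and c: "0 \<le> c"
      and le: "\<And>w. w \<in> Q \<Longrightarrow> \<kappa> n w \<le> c / norm (1 - cnj b * w) ^ 3" for b c
  proof -
    have "(\<integral>\<^sup>+ w. ennreal ((1 - norm w) powr (p - 1) * \<kappa> n w) * indicator Q w \<partial>lborel) \<le>
      (\<integral>\<^sup>+ w. ennreal c * (ennreal ((1 - norm w) powr (p - 1) / norm (1 - cnj b * w) ^ 3) * indicator unit_disc w) \<partial>lborel)"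
    proof (rule nn_integral_mono)
      fix w
      show "ennreal ((1 - norm w) powr (p - 1) * \<kappa> n w) * indicator Q w \<le>
        ennreal c * (ennreal ((1 - norm w) powr (p - 1) / norm (1 - cnj b * w) ^ 3) * indicator unit_disc w)"
      proof (cases "w \<in> Q")
        case True
        then have "(1 - norm w) powr (p - 1) * \<kappa> n w \<le> (1 - norm w) powr (p - 1) * (c / norm (1 - cnj b * w) ^ 3)"
          by (intro mult_left_mono le) auto
        then show ?thesis using True c
          by (auto simp: Q_def ennreal_mult[symmetric] mult_ac intro!: ennreal_leI)
      qed simp
    qed
    also have "\<dots> = ennreal c * I b" unfolding I_def by (rule nn_integral_cmult) simp
    also have "\<dots> \<le> ennreal c * ennreal (area_const * (1 - norm b) powr (p - 2))"
      by (intro mult_left_mono I b) simp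
    finally show ?thesis using c by (simp add: ennreal_mult')
  qed
  have "(\<integral>\<^sup>+ w. ennreal ((1 - norm w) powr (p - 1) * \<kappa> n w) * indicator Q w \<partial>lborel)
     \<le> ennreal (5832 * area_const * l powr (p + 1) * (d powr p / D powr (p + 1)))"
  proof (cases "D \<le> 54 * l")
    case True
    have "(\<integral>\<^sup>+ w. ennreal ((1 - norm w) powr (p - 1) * \<kappa> n w) * indicator Q w \<partial>lborel)
       \<le> ennreal (d\<^sup>2 * (area_const * d powr (p - 2)))"
      using from_pointwise[OF zn, of "d\<^sup>2"] n by (simp add: \<kappa>_def d_def)
    also have "d\<^sup>2 * (area_const * d powr (p - 2)) = area_const * d powr p * (d powr (2 - p) * d powr (p - 2))"
      unfolding dm by simp
    also have "d powr (2 - p) * d powr (p - 2) = 1"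
      using d by (simp add: powr_add[symmetric])
    also have "area_const * d powr p * 1 \<le> area_const * d powr p * (5832 * (l powr (p + 1) / D powr (p + 1)))"
    proof (intro mult_left_mono)
      have "D powr (p + 1) \<le> (54 * l) powr (p + 1)"
        using True D p_pos by (intro powr_mono2) auto
      also have "\<dots> = 54 powr (p + 1) * l powr (p + 1)" using l by (simp add: powr_mult)
      also have "\<dots> \<le> 54 powr 2 * l powr (p + 1)"
        using p_le_1 by (intro mult_right_mono powr_mono) auto
      also have "\<dots> \<le> 5832 * l powr (p + 1)" by (intro mult_right_mono) auto
      finally show "1 \<le> 5832 * (l powr (p + 1) / D powr (p + 1))" using D by (simp add: field_simps)
    qed (use area_const_pos in auto)
    also have "\<dots> = 5832 * area_const * l powr (p + 1) * (d powr p / D powr (p + 1))" by simp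
    finally show ?thesis by (simp add: ennreal_leI)
  next
    case False
    have "\<kappa> n w \<le> (5832 * d\<^sup>2 * l ^ 3 / D ^ 3) / norm (1 - cnj a * w) ^ 3" if w: "w \<in> Q" for w
    proof -
      define X Y where "X = norm (1 - cnj a * w)" and "Y = norm (1 - cnj (z n) * w)"
      have nw: "norm w < 1" and X9: "X \<le> 9 * l" using w by (auto simp: Q_def X_def)
      have X: "0 < X" and Y: "0 < Y"
        using norm_cnj_kernel_ge(4)[of a w] norm_cnj_kernel_ge(4)[of "z n" w] a zn nw by (auto simp: X_def Y_def)
      have "D \<le> 3 * X + Y"
        using quasi_triangle_kernel[OF a zn nw] norm_cnj_kernel_commute[of w "z n"] by (simp add: D_def X_def Y_def)
      then have "D / 2 \<le> Y" using X9 False by simp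
      then have "(D / 2) * X \<le> Y * (9 * l)" using X X9 Y by (intro mult_mono) auto
      then have "((D / 2) * X) ^ 3 \<le> (Y * (9 * l)) ^ 3" using D X by (intro power_mono) auto
      then have "D ^ 3 * X ^ 3 \<le> 5832 * l ^ 3 * Y ^ 3" by (simp add: power_mult_distrib power_divide mult_ac)
      then have "1 / Y ^ 3 \<le> 5832 * l ^ 3 / (D ^ 3 * X ^ 3)" using D X Y by (simp add: field_simps)
      then have "d\<^sup>2 * (1 / Y ^ 3) \<le> d\<^sup>2 * (5832 * l ^ 3 / (D ^ 3 * X ^ 3))" by (intro mult_left_mono) auto
      then show ?thesis using n by (simp add: \<kappa>_def X_def Y_def d_def mult_ac)
    qed
    then have "(\<integral>\<^sup>+ w. ennreal ((1 - norm w) powr (p - 1) * \<kappa> n w) * indicator Q w \<partial>lborel)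
       \<le> ennreal ((5832 * d\<^sup>2 * l ^ 3 / D ^ 3) * (area_const * l powr (p - 2)))"
      unfolding l_def using D l by (intro from_pointwise a) (auto simp: l_def)
    also have "(5832 * d\<^sup>2 * l ^ 3 / D ^ 3) * (area_const * l powr (p - 2)) =
       5832 * area_const * l powr (p + 1) * (d powr p * (d powr (2 - p) / D ^ 3))"
    proof -
      have "l ^ 3 * l powr (p - 2) = l powr (p + 1)"
        using l by (simp add: powr_add[symmetric] add.commute flip: powr_numeral)
      then show ?thesis unfolding dm by (simp add: mult_ac)
    qed
    also have "\<dots> \<le> 5832 * area_const * l powr (p + 1) * (d powr p * (1 / D powr (p + 1)))"
    proof (intro mult_left_mono)
      \<comment> \<open>Here \<open>d \<le> D\<close> is spent to pass from the exponents 2 and 3 to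
        \<open>p\<close> and \<open>p + 1\<close>, those of \<open>kernel_sum\<close>.\<close>
      have "d powr (2 - p) / D ^ 3 \<le> D powr (2 - p) / D ^ 3"
        using d D p_le_1 by (intro divide_right_mono powr_mono2) auto
      also have "\<dots> = 1 / D powr (p + 1)"
      proof -
        have "D ^ 3 = D powr (2 - p) * D powr (p + 1)"
          using D by (simp add: powr_add[symmetric] flip: powr_numeral)
        then show ?thesis using D by simp
      qed
      finally show "d powr (2 - p) / D ^ 3 \<le> 1 / D powr (p + 1)" .
    qed (use area_const_pos in auto)
    finally show ?thesis by (simp add: ennreal_leI)
  qed
  then show ?thesis by (simp only: Q_def d_def D_def)
qed

lemma \<kappa>_outside: "n \<notin> N \<Longrightarrow> \<kappa> n w = 0" by (simp add: \<kappa>_def)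

text \<open>Termwise integration reduces the claim to \<open>kernel_sum\<close> at the base point
  \<open>a\<close>, whose bound \<open>M / l\<close> brings \<open>l powr (p + 1)\<close> down to
  \<open>l powr p\<close>.\<close>

lemma nn_integral_K_near_le:
  assumes a: "norm a < 1"
  defines "l \<equiv> 1 - norm a"
  shows "(\<integral>\<^sup>+ w. ennreal ((1 - norm w) powr (p - 1) * K w) *
            indicator {w \<in> unit_disc. norm (1 - cnj a * w) \<le> 9 * l} w \<partial>lborel)
     \<le> ennreal (5832 * area_const * M * l powr p)"
proof -
  have l: "0 < l" using a by (simp add: l_def)
  define Q where "Q = {w \<in> unit_disc. norm (1 - cnj a * w) \<le> 9 * l}"
  have Q [measurable]: "Q \<in> sets borel"
  proof -
    have "closed {w. norm (1 - cnj a * w) \<le> 9 * l}" by (intro closed_Collect_le continuous_intros)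
    moreover have "Q = unit_disc \<inter> {w. norm (1 - cnj a * w) \<le> 9 * l}" by (auto simp: Q_def)
    ultimately show ?thesis by (metis borel_closed borel_open open_ball sets.Int)
  qed
  have [measurable]: "\<kappa> n \<in> borel_measurable borel" for n unfolding \<kappa>_def[abs_def] by measurable
  have "(\<integral>\<^sup>+ w. ennreal ((1 - norm w) powr (p - 1) * K w) * indicator Q w \<partial>lborel) =
    (\<integral>\<^sup>+ w. (\<Sum>n. ennreal ((1 - norm w) powr (p - 1) * \<kappa> n w) * indicator Q w) \<partial>lborel)"
  proof (rule nn_integral_cong)
    fix w
    show "ennreal ((1 - norm w) powr (p - 1) * K w) * indicator Q w =
      (\<Sum>n. ennreal ((1 - norm w) powr (p - 1) * \<kappa> n w) * indicator Q w)"
    proof (cases "w \<in> Q")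
      case True
      then have s: "summable (\<lambda>n. \<kappa> n w)" by (intro summable_\<kappa>) (simp add: Q_def)
      have "(\<Sum>n. ennreal ((1 - norm w) powr (p - 1) * \<kappa> n w)) = ennreal (\<Sum>n. (1 - norm w) powr (p - 1) * \<kappa> n w)"
        by (rule suminf_ennreal2) (auto intro!: summable_mult s simp: \<kappa>_nonneg)
      also have "(\<Sum>n. (1 - norm w) powr (p - 1) * \<kappa> n w) = (1 - norm w) powr (p - 1) * K w"
        unfolding K_def by (rule suminf_mult[OF s])
      finally show ?thesis using True by simp
    qed simp
  qed
  also have "\<dots> = (\<Sum>n. \<integral>\<^sup>+ w. ennreal ((1 - norm w) powr (p - 1) * \<kappa> n w) * indicator Q w \<partial>lborel)"
    by (rule nn_integral_suminf) measurable
  also have "\<dots> \<le> ennreal (5832 * area_const * M * l powr p)"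
  proof (rule suminf_le_const[OF summableI])
    fix m :: nat
    have "(\<Sum>n<m. \<integral>\<^sup>+ w. ennreal ((1 - norm w) powr (p - 1) * \<kappa> n w) * indicator Q w \<partial>lborel)
       = (\<Sum>n\<in>N \<inter> {..<m}. \<integral>\<^sup>+ w. ennreal ((1 - norm w) powr (p - 1) * \<kappa> n w) * indicator Q w \<partial>lborel)"
    proof (rule sum.mono_neutral_right)
      show "\<forall>n\<in>{..<m} - N \<inter> {..<m}.
          (\<integral>\<^sup>+ w. ennreal ((1 - norm w) powr (p - 1) * \<kappa> n w) * indicator Q w \<partial>lborel) = 0"
      proof
        fix n assume "n \<in> {..<m} - N \<inter> {..<m}"
        then have "n \<notin> N" by auto
        then show "(\<integral>\<^sup>+ w. ennreal ((1 - norm w) powr (p - 1) * \<kappa> n w) * indicator Q w \<partial>lborel) = 0"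
          by (simp add: \<kappa>_outside)
      qed
    qed auto
    also have "\<dots> \<le> (\<Sum>n\<in>N \<inter> {..<m}. ennreal (5832 * area_const * l powr (p + 1) *
          ((1 - norm (z n)) powr p / norm (1 - cnj a * z n) powr (p + 1))))"
      unfolding Q_def l_def by (intro sum_mono nn_integral_\<kappa>_near_le a) auto
    also have "\<dots> = ennreal (5832 * area_const * l powr (p + 1) *
          (\<Sum>n\<in>N \<inter> {..<m}. (1 - norm (z n)) powr p / norm (1 - cnj a * z n) powr (p + 1)))"
      unfolding sum_distrib_left using area_const_pos by (intro sum_ennreal) auto
    also have "\<dots> \<le> ennreal (5832 * area_const * l powr (p + 1) * (M / l))"
      unfolding l_def using area_const_pos a by (intro ennreal_leI mult_left_mono kernel_sum) auto
    also have "5832 * area_const * l powr (p + 1) * (M / l) = 5832 * area_const * M * l powr p"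
      using l by (simp add: powr_add)
    finally show "(\<Sum>n<m. \<integral>\<^sup>+ w. ennreal ((1 - norm w) powr (p - 1) * \<kappa> n w) * indicator Q w \<partial>lborel)
       \<le> ennreal (5832 * area_const * M * l powr p)" .
  qed
  finally show ?thesis by (simp only: Q_def)
qed

lemma carleson_measure_coefficient:
  assumes A: "A holomorphic_on unit_disc" and B: "0 < B"
    and le: "\<And>w. norm w < 1 \<Longrightarrow> norm (A w) \<le> B * K w / (1 - norm w)"
  shows "carleson_measure p (density (restrict_space lborel unit_disc)
           (\<lambda>w. ennreal ((norm (A w))\<^sup>2 * (1 - (norm w)\<^sup>2) powr (2 + p))))"
proof -
  define \<phi> where "\<phi> w = ennreal ((norm (A w))\<^sup>2 * (1 - (norm w)\<^sup>2) powr (2 + p))" for w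
  define \<mu> where "\<mu> = density (restrict_space lborel unit_disc) \<phi>"
  have sets_eq: "sets (restrict_space lborel unit_disc) = sets (restrict_space borel unit_disc)"
    by (rule sets_restrict_space_cong) simp
  have "\<phi> \<in> borel_measurable (restrict_space borel unit_disc)"
  proof -
    have "continuous_on unit_disc A" by (rule holomorphic_on_imp_continuous_on[OF A])
    then have [measurable]: "A \<in> borel_measurable (restrict_space borel unit_disc)"
      by (rule borel_measurable_continuous_on_restrict)
    have [measurable]: "(\<lambda>w. w) \<in> borel_measurable (restrict_space borel unit_disc)"
      by (rule measurable_restrict_space1) simp
    show ?thesis unfolding \<phi>_def[abs_def] by measurable
  qed
  then have \<phi>_meas: "\<phi> \<in> borel_measurable (restrict_space lborel unit_disc)"
    using measurable_cong_sets[OF sets_eq refl] by blast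
  \<comment> \<open>The 8 bounds \<open>2 powr (2 + p)\<close>, which comes from
    \<open>1 - (norm w) ^ 2 \<le> 2 * (1 - norm w)\<close>.\<close>
  define c where "c = 8 * B\<^sup>2 * M"
  have c: "0 < c" using B M_pos by (simp add: c_def)
  have \<phi>_le: "\<phi> w \<le> ennreal c * ennreal ((1 - norm w) powr (p - 1) * K w)" if w: "norm w < 1" for w
  proof -
    define d where "d = 1 - norm w"
    have d: "0 < d" using w by (simp add: d_def)
    have "1 - (norm w)\<^sup>2 \<le> 2 * d"
      using zero_le_power2[of "1 - norm w"] by (simp add: d_def power2_diff)
    then have "(1 - (norm w)\<^sup>2) powr (2 + p) \<le> (2 * d) powr (2 + p)"
      using w p_pos by (intro powr_mono2) (auto simp: power_le_one)
    also have "\<dots> = 2 powr (2 + p) * d powr (2 + p)" using d by (simp add: powr_mult)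
    also have "\<dots> \<le> 2 powr 3 * d powr (2 + p)"
      using p_le_1 by (intro mult_right_mono powr_mono) auto
    finally have 1: "(1 - (norm w)\<^sup>2) powr (2 + p) \<le> 8 * d powr (2 + p)" by simp
    have 2: "(norm (A w))\<^sup>2 \<le> B\<^sup>2 * (K w * (M / d)) / d\<^sup>2"
    proof -
      have "(norm (A w))\<^sup>2 \<le> (B * K w / d)\<^sup>2" using le[OF w] by (intro power_mono) (auto simp: d_def)
      also have "\<dots> = B\<^sup>2 * (K w * K w) / d\<^sup>2" by (simp add: power2_eq_square)
      also have "\<dots> \<le> B\<^sup>2 * (K w * (M / d)) / d\<^sup>2"
        using K_le[OF w] K_nonneg[OF w] by (intro divide_right_mono mult_left_mono) (auto simp: d_def)
      finally show ?thesis .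
    qed
    have "(norm (A w))\<^sup>2 * (1 - (norm w)\<^sup>2) powr (2 + p) \<le>
        (B\<^sup>2 * (K w * (M / d)) / d\<^sup>2) * (8 * d powr (2 + p))"
      using 1 2 K_nonneg[OF w] M_pos d by (intro mult_mono) auto
    also have "\<dots> = c * (d powr (p - 1) * K w)"
    proof -
      have "d powr (2 + p) = d ^ 3 * d powr (p - 1)"
        using d by (simp add: powr_add[symmetric] flip: powr_numeral)
      then show ?thesis using d by (simp add: c_def power2_eq_square power3_eq_cube)
    qed
    finally show ?thesis
      using c K_nonneg[OF w] unfolding \<phi>_def d_def
      by (subst ennreal_mult[symmetric]) (auto intro!: ennreal_leI)
  qed
  define R where "R = c * (5832 * area_const * M)"
  have R: "0 \<le> R" using c area_const_pos M_pos by (simp add: R_def)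
  have box: "emeasure \<mu> (carleson_square J) / ennreal (arc_length J powr p) \<le> ennreal R"
    if J: "J \<in> arc_angles" for J
  proof -
    define l where "l = arc_length J"
    obtain a where a: "norm a < 1" "1 - norm a = l"
      "carleson_square J \<subseteq> {w \<in> unit_disc. norm (1 - cnj a * w) \<le> 9 * l}"
      using carleson_square_subset[OF J] unfolding l_def by metis
    define Q where "Q = {w \<in> unit_disc. norm (1 - cnj a * w) \<le> 9 * l}"
    have l: "0 < l" using a by simp
    have closed: "closed {w. norm (1 - cnj a * w) \<le> 9 * l}" by (intro closed_Collect_le continuous_intros)
    have "Q = unit_disc \<inter> {w. norm (1 - cnj a * w) \<le> 9 * l}" by (auto simp: Q_def)
    then have Q: "Q \<in> sets (restrict_space lborel unit_disc)"
      unfolding sets_eq sets_restrict_space by (rule image_eqI) (simp only: sets_lborel borel_closed[OF closed])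
    \<comment> \<open>Monotonicity asks for measurability of the enclosing set \<open>Q\<close>, so
      open, closed and half-open arcs are treated alike.\<close>
    have "emeasure \<mu> (carleson_square J) \<le> emeasure \<mu> Q"
      by (rule emeasure_mono) (use a(3) Q in \<open>auto simp: Q_def \<mu>_def\<close>)
    also have "\<dots> = (\<integral>\<^sup>+ w. \<phi> w * indicator Q w \<partial>restrict_space lborel unit_disc)"
      unfolding \<mu>_def by (rule emeasure_density[OF \<phi>_meas Q])
    also have "\<dots> = (\<integral>\<^sup>+ w. \<phi> w * indicator Q w * indicator unit_disc w \<partial>lborel)"
      by (rule nn_integral_restrict_space) simp
    also have "\<dots> \<le> (\<integral>\<^sup>+ w. ennreal c * (ennreal ((1 - norm w) powr (p - 1) * K w) * indicator Q w) \<partial>lborel)"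
      using \<phi>_le by (intro nn_integral_mono) (auto simp: indicator_def Q_def)
    also have "\<dots> = ennreal c * (\<integral>\<^sup>+ w. ennreal ((1 - norm w) powr (p - 1) * K w) * indicator Q w \<partial>lborel)"
    proof (rule nn_integral_cmult)
      have [measurable]: "\<kappa> n \<in> borel_measurable borel" for n unfolding \<kappa>_def[abs_def] by measurable
      have [measurable]: "Q \<in> sets borel"
        using Q by (simp add: sets_restrict_space_iff)
      show "(\<lambda>w. ennreal ((1 - norm w) powr (p - 1) * K w) * indicator Q w) \<in> borel_measurable lborel"
        unfolding K_def by measurable
    qed
    also have "\<dots> \<le> ennreal c * ennreal (5832 * area_const * M * l powr p)"
      using nn_integral_K_near_le[OF a(1)] unfolding Q_def a(2) by (intro mult_left_mono) auto
    also have "\<dots> = ennreal (l powr p) * ennreal R"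
      using c by (simp add: R_def ennreal_mult'[symmetric] ennreal_mult''[symmetric] mult_ac)
    finally show ?thesis unfolding l_def[symmetric] using l by (intro divide_le_posI_ennreal) auto
  qed
  have "(SUP J\<in>arc_angles. emeasure \<mu> (carleson_square J) / ennreal (arc_length J powr p)) \<le> ennreal R"
    by (rule SUP_least) (rule box)
  also have "\<dots> < \<infinity>" by simp
  finally have "carleson_measure p \<mu>"
    using sets_eq by (simp add: carleson_measure_def \<mu>_def)
  then show ?thesis by (simp add: \<mu>_def \<phi>_def[abs_def])
qed

end

section \<open>From the hypotheses of the theorem to the locale\<close>

lemma carleson_points_exists:
  assumes p: "0 < p" "p \<le> 1" and z: "\<And>n. n \<in> N \<Longrightarrow> z n \<in> unit_disc"
    and sep: "separated_seq N z"
    and C: "carleson_measure p (dirac_sum N (\<lambda>n. (1 - norm (z n)) powr p) z)"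
  obtains \<delta> M where "carleson_points p N z \<delta> M"
proof -
  obtain \<delta>0 where \<delta>0: "0 < \<delta>0" "\<And>n k. n \<in> N \<Longrightarrow> k \<in> N \<Longrightarrow> n \<noteq> k \<Longrightarrow>
      \<delta>0 < norm (z n - z k) / norm (1 - cnj (z n) * z k)"
    using sep unfolding separated_seq_def by blast
  have nz: "norm (z n) < 1" if "n \<in> N" for n using z[OF that] by simp
  obtain M where M: "0 < M" "\<And>S a r. finite S \<Longrightarrow> S \<subseteq> N \<Longrightarrow> norm a < 1 \<Longrightarrow> 0 < r \<Longrightarrow>
       (\<Sum>n | n \<in> S \<and> norm (1 - cnj a * z n) < r. (1 - norm (z n)) powr p) \<le> M * r powr p"
    by (rule carleson_dirac_sum_le[OF z C powr_ge_zero p(1)]) (assumption | (rule that; assumption))+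
  have "carleson_points p N z (min 1 \<delta>0) (4 * M)"
  proof
    fix n k assume nk: "n \<in> N" "k \<in> N" "n \<noteq> k"
    have X: "0 < norm (1 - cnj (z n) * z k)"
      by (rule norm_cnj_kernel_ge(4)[OF nz[OF nk(1)] less_imp_le[OF nz[OF nk(2)]]])
    have "min 1 \<delta>0 * norm (1 - cnj (z n) * z k) \<le> \<delta>0 * norm (1 - cnj (z n) * z k)"
      by (intro mult_right_mono) auto
    also have "\<dots> \<le> norm (z n - z k)" using \<delta>0(2)[OF nk] X by (simp add: field_simps)
    finally show "min 1 \<delta>0 * norm (1 - cnj (z n) * z k) \<le> norm (z n - z k)" .
  next
    fix S and a :: complex assume S: "finite S" "S \<subseteq> N" and a: "norm a < 1"
    show "(\<Sum>n\<in>S. (1 - norm (z n)) powr p / norm (1 - cnj a * z n) powr (p + 1)) \<le> 4 * M / (1 - norm a)"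
      by (rule dyadic_kernel_sum_le) (use S a p M nz in auto)
  qed (use p nz \<delta>0 M in auto)
  then show thesis by (rule that)
qed

theorem theorem3:
  fixes p :: real and N :: "nat set" and z :: "nat \<Rightarrow> complex"
  assumes "0 < p" and "p \<le> 1"
    and "\<And>n. n \<in> N \<Longrightarrow> z n \<in> unit_disc"
    and "separated_seq N z"
    and "carleson_measure p (dirac_sum N (\<lambda>n. (1 - norm (z n)) powr p) z)"
  shows "\<exists>A :: complex \<Rightarrow> complex.
           A holomorphic_on unit_disc \<and>
           carleson_measure p
             (density (restrict_space lborel unit_disc)
                (\<lambda>w. ennreal ((norm (A w))\<^sup>2 * (1 - (norm w)\<^sup>2) powr (2 + p)))) \<and>
           (\<exists>f. f holomorphic_on unit_disc \<and>
                (\<forall>w\<in>unit_disc. deriv (deriv f) w + A w * f w = 0) \<and>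
                (\<exists>w\<in>unit_disc. f w \<noteq> 0) \<and>
                zero_sequence f N z)"
proof -
  obtain \<delta> M where "carleson_points p N z \<delta> M"
    using carleson_points_exists[OF assms] by metis
  then interpret carleson_points p N z \<delta> M .
  obtain A f B where *: "A holomorphic_on unit_disc" "f holomorphic_on unit_disc"
    "0 < B" "\<And>w. norm w < 1 \<Longrightarrow> norm (A w) \<le> B * K w / (1 - norm w)"
    "\<And>w. norm w < 1 \<Longrightarrow> deriv (deriv f) w + A w * f w = 0"
    "\<exists>w\<in>unit_disc. f w \<noteq> 0" "zero_sequence f N z"
    by (rule equation_exists) (rule that; assumption)
  show ?thesis
    using * carleson_measure_coefficient[OF *(1,3,4)] by (intro exI[of _ A] exI[of _ f] conjI ballI) auto
qed

end
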